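(* Let $\Pi(dt,dz)$ be a Poisson random measure on $[0,\infty)\times[0,\infty)$ with intensity $dt\,dz$. Let $\varphi:[0,\infty)\to[0,\infty)$ be measurable with $\int_0^\infty\varphi(t)\,dt=1$, let $F(x)=\int_0^x\varphi(t)\,dt$, and assume that for some $\alpha\in(1/2,1)$ and $K>0$, $$\lim_{x\to+\infty}\alpha x^{\alpha}\bigl(1-F(x)\bigr)=K .$$ Put $\delta:=K\Gamma(1-\alpha)/\alpha$. Let $(a_n)_{n\ge1}$ and $(\mu_n)_{n\ge1}$ be positive sequences such that, for some $\lambda>0$ and $\mu^*>0$: $a_n>1$ for all $n$, $\lim_n a_n=1$, $\lim_n n^{\alpha}(a_n-1)=\lambda\delta$, and $\lim_n n^{1-\alpha}\mu_n=\mu^*\delta$. Let $\varphi^n=a_n\varphi$ and let $Z^n$ be the (unique càdlàg adapted) solution of $$Z^n_t=\int_0^t\int_0^\infty \mathbf 1_{\{z\le\lambda^n_s\}}\Pi(ds,dz),\qquad \lambda^n_t=\mu_n+\int_{[0,t)}\varphi^n(t-s)\,dZ^n_s,\qquad t\ge0.$$ Let $M^n_t=Z^n_t-\int_0^t\lambda^n_s\,ds$, and for $t\in[0,1]$ set $X^n_t=Z^n_{nt}/n^{2\alpha}$ and $\overline M^n_t=M^n_{nt}/n^{\alpha}$. Let $(X,M^* )$ be a limit point of $(X^n,\overline M^n)$, i.e. a limit in law along some subsequence in $D([0,1],\mathbb R)^2$ with the Skorokhod topology. Then $X$ satisfies, for $t\in[0,1]$, $$X_t=\frac{\mu^*}{\lambda}\int_0^t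 f^{\alpha,\lambda}(t-s)\,s\,ds+\frac{1}{\lambda\delta}\int_0^t f^{\alpha,\lambda}(t-s)M^*_s\,ds,$$ where $f^{\alpha,\lambda}(x)=\lambda x^{\alpha-1}E_{\alpha,\alpha}(\lambda x^{\alpha})$ for $x>0$.
   Context: $E_{\kappa,\beta}(x)=\sum_{k\ge0}x^k/\Gamma(\kappa k+\beta)$ is the Mittag-Leffler function and $\Gamma$ is the Gamma function. The function $f^{\alpha,\lambda}$ has Laplace transform $\int_0^\infty e^{-zt}f^{\alpha,\lambda}(t)dt=\lambda/(z^\alpha-\lambda)$. Here $\int_0^t$ means $\int_{[0,t]}$. *)

theory Defs
  imports "HOL-Probability.Probability"
begin

definition mittag_leffler :: "real \<Rightarrow> real \<Rightarrow> real \<Rightarrow> real" where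
  "mittag_leffler \<kappa> \<beta> x = (\<Sum>k. x ^ k / Gamma (\<kappa> * real k + \<beta>))"

text \<open>f^{alpha,lambda}(x) = lambda x^(alpha-1) E_{alpha,alpha}(lambda x^alpha) for x > 0
  (the value at x <= 0 is irrelevant; we set it to 0).\<close>
definition f_al :: "real \<Rightarrow> real \<Rightarrow> real \<Rightarrow> real" where
  "f_al \<alpha> lm x = (if x > 0 then lm * x powr (\<alpha> - 1) * mittag_leffler \<alpha> \<alpha> (lm * x powr \<alpha>) else 0)"

definition poisson_random_measure :: "'a measure \<Rightarrow> ('a \<Rightarrow> (real \<times> real) measure) \<Rightarrow> bool" where
  "poisson_random_measure M PP \<longleftrightarrow>
     prob_space M \<and>
     (\<forall>\<omega>\<in>space M. sets (PP \<omega>) = sets borel \<and> emeasure (PP \<omega>) (- ({0..} \<times> {0..})) = 0) \<and>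
     (\<forall>A \<in> sets borel. A \<subseteq> {0..} \<times> {0..} \<longrightarrow> emeasure lborel A < \<infinity> \<longrightarrow>
        (\<lambda>\<omega>. emeasure (PP \<omega>) A) \<in> borel_measurable M \<and>
        (\<forall>k::nat. measure M {\<omega>\<in>space M. emeasure (PP \<omega>) A = of_nat k}
                  = measure lborel A ^ k / fact k * exp (- measure lborel A))) \<and>
     (\<forall>(I::nat set) A. finite I \<longrightarrow> disjoint_family_on A I \<longrightarrow>
        (\<forall>i\<in>I. A i \<in> sets borel \<and> A i \<subseteq> {0..} \<times> {0..} \<and> emeasure lborel (A i) < \<infinity>) \<longrightarrow>
        prob_space.indep_vars M (\<lambda>_. borel) (\<lambda>i \<omega>. emeasure (PP \<omega>) (A i)) I)"

definition cadlag01 :: "(real \<Rightarrow> real) \<Rightarrow> bool" where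
  "cadlag01 x \<longleftrightarrow> (\<forall>t\<in>{0..<1}. continuous (at_right t) x) \<and>
                   (\<forall>t\<in>{0<..1}. \<exists>l. (x \<longlongrightarrow> l) (at_left t))"

definition time_changes01 :: "(real \<Rightarrow> real) set" where
  "time_changes01 = {l. continuous_on {0..1} l \<and> strict_mono_on {0..1} l \<and> l 0 = 0 \<and> l 1 = 1}"

definition skor_dist :: "(real \<Rightarrow> real) \<Rightarrow> (real \<Rightarrow> real) \<Rightarrow> real" where
  "skor_dist x y = Inf {e. \<exists>l\<in>time_changes01.
       (\<forall>t\<in>{0..1}. \<bar>l t - t\<bar> \<le> e \<and> \<bar>x t - y (l t)\<bar> \<le> e)}"

definition skor_continuous2 :: "((real \<Rightarrow> real) \<Rightarrow> (real \<Rightarrow> real) \<Rightarrow> real) \<Rightarrow> bool" where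
  "skor_continuous2 G \<longleftrightarrow> (\<forall>x y. cadlag01 x \<longrightarrow> cadlag01 y \<longrightarrow>
     (\<forall>\<epsilon>>0. \<exists>\<delta>>0. \<forall>x' y'. cadlag01 x' \<longrightarrow> cadlag01 y' \<longrightarrow>
        skor_dist x' x < \<delta> \<longrightarrow> skor_dist y' y < \<delta> \<longrightarrow> \<bar>G x' y' - G x y\<bar> < \<epsilon>))"

end

theory Submission
  imports Defs
begin

text \<open>The martingale structure plays no role: the limit equation is inherited from a pathwise linear identity.
  Integrating the intensity equation and rescaling gives, for every \<open>n\<close> and almost every path, the renewal
  equation \<open>n powr \<alpha> * (X - a * (p * X)) = M + n powr (1 - \<alpha>) * \<mu> * t\<close> with \<open>p v = n * \<phi> (n * v)\<close>, and one
  further integration replaces its left-hand side by the convolution of \<open>X\<close> with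
  \<open>n powr \<alpha> * (1 - a * F (n * w))\<close>. By the tail assumption these kernels converge in \<open>L\<^sup>1\<close> to
  \<open>\<delta> * (w powr (- \<alpha>) / Gamma (1 - \<alpha>) - lm)\<close>, which \<open>f_al \<alpha> lm\<close> inverts.
  Convolving with \<open>f_al \<alpha> lm\<close> thus yields functionals, continuous in the Skorokhod topology, that vanish
  asymptotically along the prelimit, hence almost surely vanish at the limit point.
  They determine the limit on \<open>[0,1)\<close> by right continuity. The endpoint needs a separate
  argument: the renewal equation at time 1 bounds the increment of \<open>X\<close> over \<open>[1 - \<eta>, 1]\<close>, so the limit does not
  jump there.\<close>

section \<open>Convolution on the line\<close>

text \<open>The operator in the renewal equation is \<open>n powr \<alpha>\<close> times a Dirac
  mass minus an almost critical density; it tends to an operator of fractional differentiation and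
  has no function as its limit. Integrating once more replaces it by a kernel of size
  \<open>w powr (- \<alpha>)\<close>, integrable because \<alpha> < 1, so that L1 convergence
  against paths bounded by \<open>x 1\<close> suffices. The limit kernel carries two effects: the
  tail of \<phi> gives \<open>K / \<alpha> * w powr (- \<alpha>)\<close>, near-criticality gives
  \<open>- lm * \<delta>\<close>, and \<delta> is the constant that turns the former into \<delta>
  times the fractional kernel. The price is that the limit identity is one between integrals of
  paths and cannot see the value at 1. The remedy is that the kernel at a small lag \<eta> is large:
  in the equation at time 1, the coefficients of the path at 1 and of its average over
  \<open>[1 - \<eta>, 1]\<close> both grow like \<open>\<eta> powr (- \<alpha>)\<close>, while all
  other terms stay bounded.\<close>

definition conv :: "(real \<Rightarrow> real) \<Rightarrow> (real \<Rightarrow> real) \<Rightarrow> real \<Rightarrow> real" where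
  "conv u v t = (LINT s|lborel. u s * v (t - s))"

lemma integrable_reflect:
  fixes v :: "real \<Rightarrow> real"
  assumes "integrable lborel v"
  shows "integrable lborel (\<lambda>s. v (t - s))"
  using lborel_integrable_real_affine[OF assms, of "-1" t] by simp

lemma conv_commute: "conv u v t = conv v u t"
  unfolding conv_def
  using lborel_integral_real_affine[of "-1" "\<lambda>s. u s * v (t - s)" t] by (simp add: mult.commute)

lemma integrable_conv_pair:
  fixes u v :: "real \<Rightarrow> real"
  assumes u: "integrable lborel u" and v: "integrable lborel v"
  shows "integrable (lborel \<Otimes>\<^sub>M lborel) (\<lambda>(a, c). u a * v (c - a))"
proof (rule lborel_pair.Fubini_integrable)
  have [measurable]: "u \<in> borel_measurable borel" "v \<in> borel_measurable borel"
    using u v by (auto dest: borel_measurable_integrable)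
  show "(\<lambda>(a, c). u a * v (c - a)) \<in> borel_measurable (lborel \<Otimes>\<^sub>M lborel)"
    by measurable
  have sh: "integrable lborel (\<lambda>c. v (c - a))" for a
    using lborel_integrable_real_affine[OF v, of 1 "-a"] by (simp add: algebra_simps)
  then show "AE a in lborel. integrable lborel (\<lambda>c. case (a, c) of (a, c) \<Rightarrow> u a * v (c - a))"
    by simp
  have "(LINT c|lborel. norm (u a * v (c - a))) = \<bar>u a\<bar> * (LINT c|lborel. \<bar>v c\<bar>)" for a
    using lborel_integral_real_affine[of 1 "\<lambda>c. \<bar>v c\<bar>" "-a"] by (simp add: abs_mult algebra_simps)
  then show "integrable lborel
     (\<lambda>a. LINT c|lborel. norm (case (a, c) of (a, c) \<Rightarrow> u a * v (c - a)))"
    using u by simp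
qed

lemma integrable_conv:
  assumes u: "integrable lborel u" and v: "integrable lborel v"
  shows "integrable lborel (conv u v)"
  using lborel_pair.integrable_snd[OF integrable_conv_pair[OF u v]]
  by (simp add: conv_def [abs_def])

lemma integrable_mult_bounded:
  fixes u w :: "real \<Rightarrow> real"
  assumes u: "integrable M u" and w[measurable]: "w \<in> borel_measurable M" and b: "\<And>s. \<bar>w s\<bar> \<le> B"
  shows "integrable M (\<lambda>s. u s * w s)"
proof (rule Bochner_Integration.integrable_bound[of M "\<lambda>s. B * \<bar>u s\<bar>"])
  show "integrable M (\<lambda>s. B * \<bar>u s\<bar>)" using u by simp
  show "(\<lambda>s. u s * w s) \<in> borel_measurable M" using u by (auto dest: borel_measurable_integrable)
  show "AE s in M. norm (u s * w s) \<le> norm (B * \<bar>u s\<bar>)"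
  proof (rule AE_I2)
    fix s
    have "\<bar>w s\<bar> \<le> \<bar>B\<bar>" using b[of s] by linarith
    then show "norm (u s * w s) \<le> norm (B * \<bar>u s\<bar>)"
      by (simp add: abs_mult mult.commute[of "\<bar>B\<bar>"] mult_left_mono)
  qed
qed

lemma integrable_conv_integrand:
  fixes u w :: "real \<Rightarrow> real"
  assumes u: "integrable lborel u" and [measurable]: "w \<in> borel_measurable borel" and b: "\<And>s. \<bar>w s\<bar> \<le> B"
  shows "integrable lborel (\<lambda>s. u s * w (t - s))"
  by (rule integrable_mult_bounded[OF u, where B = B]) (use b in auto)

lemma abs_conv_le:
  assumes u: "integrable lborel u" and b: "\<And>s. \<bar>w s\<bar> \<le> B"
  shows "\<bar>conv u w t\<bar> \<le> (LINT s|lborel. \<bar>u s\<bar>) * B"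
proof -
  have "\<bar>conv u w t\<bar> \<le> (LINT s|lborel. \<bar>u s * w (t - s)\<bar>)"
    unfolding conv_def by (rule integral_abs_bound)
  also have "\<dots> \<le> (LINT s|lborel. \<bar>u s\<bar> * B)"
  proof (rule integral_mono')
    have "0 \<le> B" using b[of 0] by linarith
    then show "\<And>s. 0 \<le> \<bar>u s\<bar> * B" by simp
  qed (use u b in \<open>auto simp: abs_mult intro!: mult_left_mono\<close>)
  finally show ?thesis by simp
qed

lemma borel_measurable_conv [measurable]:
  assumes [measurable]: "u \<in> borel_measurable borel" "v \<in> borel_measurable borel"
  shows "conv u v \<in> borel_measurable borel"
proof -
  have "(\<lambda>t. LINT s|lborel. u s * v (t - s)) \<in> borel_measurable borel"
    by measurable
  then show ?thesis by (simp add: conv_def [abs_def])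
qed

text \<open>Fubini. Boundedness of the third factor dominates the double integrand by
  \<open>B\<close> times an integrable function on the plane, for every \<open>t\<close>; hence the
  identity holds at each point and not only almost everywhere, as evaluation at fixed times
  requires.\<close>

lemma conv_assoc:
  assumes u: "integrable lborel u" and v: "integrable lborel v"
    and w[measurable]: "w \<in> borel_measurable borel" and b: "\<And>s. \<bar>w s\<bar> \<le> B"
  shows "conv (conv u v) w t = conv u (conv v w) t"
proof -
  have "integrable (lborel \<Otimes>\<^sub>M lborel) (\<lambda>p. (case p of (a, c) \<Rightarrow> u a * v (c - a)) * w (t - snd p))"
  proof (rule Bochner_Integration.integrable_bound
        [of _ "\<lambda>p. B * \<bar>case p of (a, c) \<Rightarrow> u a * v (c - a)\<bar>"])
    have [measurable]: "u \<in> borel_measurable borel" "v \<in> borel_measurable borel"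
      using u v by (auto dest: borel_measurable_integrable)
    show "(\<lambda>p. (case p of (a, c) \<Rightarrow> u a * v (c - a)) * w (t - snd p))
        \<in> borel_measurable (lborel \<Otimes>\<^sub>M lborel)"
      by measurable
    show "integrable (lborel \<Otimes>\<^sub>M lborel) (\<lambda>p. B * \<bar>case p of (a, c) \<Rightarrow> u a * v (c - a)\<bar>)"
      using integrable_conv_pair[OF u v] by simp
    show "AE p in lborel \<Otimes>\<^sub>M lborel. norm ((case p of (a, c) \<Rightarrow> u a * v (c - a)) * w (t - snd p))
        \<le> norm (B * \<bar>case p of (a, c) \<Rightarrow> u a * v (c - a)\<bar>)"
    proof (rule AE_I2)
      fix p :: "real \<times> real"
      have "\<bar>w (t - snd p)\<bar> \<le> \<bar>B\<bar>" using b[of "t - snd p"] by linarith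
      then show "norm ((case p of (a, c) \<Rightarrow> u a * v (c - a)) * w (t - snd p))
        \<le> norm (B * \<bar>case p of (a, c) \<Rightarrow> u a * v (c - a)\<bar>)"
        by (simp add: abs_mult mult.commute mult_right_mono)
    qed
  qed
  then have "integrable (lborel \<Otimes>\<^sub>M lborel) (\<lambda>(a, c). u a * v (c - a) * w (t - c))"
    by (simp add: case_prod_beta')
  from lborel_pair.Fubini_integral[OF this]
  have "(LINT c|lborel. LINT a|lborel. u a * v (c - a) * w (t - c))
      = (LINT a|lborel. LINT c|lborel. u a * v (c - a) * w (t - c))" by simp
  moreover have "(LINT c|lborel. u a * v (c - a) * w (t - c)) = u a * conv v w (t - a)" for a
    using lborel_integral_real_affine[of 1 "\<lambda>c. v (c - a) * w (t - c)" a]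
    by (simp add: conv_def algebra_simps)
  ultimately show ?thesis by (simp add: conv_def)
qed

lemma conv_add:
  assumes u: "integrable lborel u" and "w \<in> borel_measurable borel" "\<And>s. \<bar>w s\<bar> \<le> B"
    "w' \<in> borel_measurable borel" "\<And>s. \<bar>w' s\<bar> \<le> B'"
  shows "conv u (\<lambda>s. w s + w' s) t = conv u w t + conv u w' t"
  unfolding conv_def distrib_left
  by (rule Bochner_Integration.integral_add; rule integrable_conv_integrand; fact)

lemma conv_cmult: "conv u (\<lambda>s. c * w s) t = c * conv u w t"
proof -
  have "(\<lambda>s. u s * (c * w (t - s))) = (\<lambda>s. c * (u s * w (t - s)))" by (auto simp: fun_eq_iff)
  then show ?thesis by (simp add: conv_def)
qed

text \<open>Dominated convergence: for given \<open>t\<close> the lags \<open>s\<close> with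
  \<open>t - s\<close> in \<open>D\<close> are countably many, hence null. This is the source of the
  continuity of the right-hand side of the limit equation.\<close>

lemma continuous_conv:
  fixes w :: "real \<Rightarrow> real"
  assumes u: "integrable lborel u" and [measurable]: "w \<in> borel_measurable borel"
    and b: "\<And>s. \<bar>w s\<bar> \<le> B" and D: "countable D" "\<And>s. s \<notin> D \<Longrightarrow> isCont w s"
  shows "isCont (conv u w) t"
  unfolding continuous_within_sequentially
proof (intro allI impI)
  fix x :: "nat \<Rightarrow> real" assume x: "(\<forall>n. x n \<in> UNIV) \<and> x \<longlonglongrightarrow> t"
  have [measurable]: "u \<in> borel_measurable borel" using u by (auto dest: borel_measurable_integrable)
  have "countable ((\<lambda>d. t - d) ` D)" using D(1) by (rule countable_image)
  then have "(\<lambda>d. t - d) ` D \<in> null_sets lborel" by (rule countable_imp_null_set_lborel)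
  then have ae: "AE s in lborel. s \<notin> (\<lambda>d. t - d) ` D" by (rule AE_not_in)
  have "(\<lambda>n. LINT s|lborel. u s * w (x n - s)) \<longlonglongrightarrow> (LINT s|lborel. u s * w (t - s))"
  proof (rule integral_dominated_convergence[where w = "\<lambda>s. \<bar>u s\<bar> * B"])
    show "integrable lborel (\<lambda>s. \<bar>u s\<bar> * B)" using u by simp
    show "AE s in lborel. (\<lambda>n. u s * w (x n - s)) \<longlonglongrightarrow> u s * w (t - s)"
      using ae
    proof eventually_elim
      case (elim s)
      then have "t - s \<notin> D" by (metis diff_diff_eq2 add_diff_cancel_left' image_eqI)
      moreover have "(\<lambda>n. x n - s) \<longlonglongrightarrow> t - s" using x by (intro tendsto_intros) auto
      ultimately show ?case by (intro tendsto_mult[OF tendsto_const] isCont_tendsto_compose[OF D(2)])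
    qed
    show "AE s in lborel. norm (u s * w (x n - s)) \<le> \<bar>u s\<bar> * B" for n
      using b by (intro AE_I2) (auto simp: abs_mult intro!: mult_left_mono)
  qed measurable
  then show "(conv u w \<circ> x) \<longlonglongrightarrow> conv u w t" by (simp add: conv_def comp_def)
qed

section \<open>The Mittag-Leffler kernel\<close>

text \<open>Only the part of Euler's integral over \<open>[A, \<infinity>)\<close> is kept, where
  \<open>t powr (x - 1)\<close> is at least \<open>A powr (x - 1)\<close>. Since \<open>A\<close> is
  free, Gamma outgrows every geometric sequence.\<close>

lemma Gamma_ge_powr_exp:
  fixes x A :: real
  assumes x: "1 \<le> x" and A: "0 < A"
  shows "A powr (x - 1) * exp (- A) \<le> Gamma x"
proof -
  have "((\<lambda>t. - exp (- t)) \<longlongrightarrow> (0::real)) at_top" by real_asymp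
  then have "(\<integral>\<^sup>+t. ennreal (exp (- t)) * indicator {A..} t \<partial>lborel) = ennreal (0 - (- exp (- A)))"
    by (intro nn_integral_FTC_atLeast) (auto intro!: derivative_eq_intros)
  then have "ennreal (A powr (x - 1) * exp (- A))
      = ennreal (A powr (x - 1)) * (\<integral>\<^sup>+t. ennreal (exp (- t)) * indicator {A..} t \<partial>lborel)"
    by (simp add: ennreal_mult)
  also have "\<dots> = (\<integral>\<^sup>+t. ennreal (A powr (x - 1)) * (ennreal (exp (- t)) * indicator {A..} t) \<partial>lborel)"
    by (rule nn_integral_cmult[symmetric]) simp
  also have "\<dots> \<le> (\<integral>\<^sup>+t. ennreal (indicator {0..} t * t powr (x - 1) / exp t) \<partial>lborel)"
  proof (rule nn_integral_mono)
    fix t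
    show "ennreal (A powr (x - 1)) * (ennreal (exp (- t)) * indicator {A..} t)
        \<le> ennreal (indicator {0..} t * t powr (x - 1) / exp t)"
    proof (cases "A \<le> t")
      case True
      then have "A powr (x - 1) * exp (- t) \<le> t powr (x - 1) * exp (- t)"
        using x A by (intro mult_right_mono powr_mono2) auto
      with True A show ?thesis
        by (auto simp: exp_minus divide_inverse ennreal_mult[symmetric] intro!: ennreal_leI)
    qed simp
  qed
  also have "\<dots> = ennreal (Gamma x)" using x by (simp add: Gamma_conv_nn_integral_real)
  finally show ?thesis using x by (simp add: Gamma_real_nonneg)
qed

lemma summable_mittag_leffler:
  fixes y :: real
  assumes \<kappa>: "0 < \<kappa>" and \<beta>: "0 < \<beta>"
  shows "summable (\<lambda>k. y ^ k / Gamma (\<kappa> * real k + \<beta>))"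
proof -
  \<comment> \<open>Chosen so that \<open>A powr \<kappa> = 2 * \<bar>y\<bar> + 1\<close>, which
    makes the terms decay like a geometric series of ratio \<open>q\<close>.\<close>
  define A where "A = (2 * \<bar>y\<bar> + 1) powr (1 / \<kappa>)"
  define q where "q = \<bar>y\<bar> / (2 * \<bar>y\<bar> + 1)"
  have A: "0 < A" "A powr \<kappa> = 2 * \<bar>y\<bar> + 1" using \<kappa> by (auto simp: A_def powr_powr)
  have q: "0 \<le> q" "q < 1" by (auto simp: q_def field_simps)
  have ev: "eventually (\<lambda>k. 1 \<le> \<kappa> * real k + \<beta>) sequentially"
    using \<kappa> by real_asymp
  have "eventually (\<lambda>k. norm (y ^ k / Gamma (\<kappa> * real k + \<beta>)) \<le> A powr (1 - \<beta>) * exp A * q ^ k) sequentially"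
    using ev
  proof eventually_elim
    case (elim k)
    have "A powr (\<kappa> * real k + \<beta> - 1) = (A powr \<kappa>) powr real k / A powr (1 - \<beta>)"
    proof -
      have "\<kappa> * real k + \<beta> - 1 = \<kappa> * real k - (1 - \<beta>)" by simp
      then show ?thesis by (simp only: powr_diff powr_powr)
    qed
    also have "\<dots> = (2 * \<bar>y\<bar> + 1) ^ k / A powr (1 - \<beta>)"
      unfolding A(2) by (subst powr_realpow) auto
    finally have "(2 * \<bar>y\<bar> + 1) ^ k / A powr (1 - \<beta>) * exp (- A) \<le> Gamma (\<kappa> * real k + \<beta>)"
      using Gamma_ge_powr_exp[OF elim A(1)] by simp
    moreover have "0 < (2 * \<bar>y\<bar> + 1) ^ k / A powr (1 - \<beta>) * exp (- A)"
      using A by simp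
    moreover from this have "0 < Gamma (\<kappa> * real k + \<beta>)"
      using elim by (intro Gamma_real_pos) simp
    ultimately have "\<bar>y\<bar> ^ k / Gamma (\<kappa> * real k + \<beta>)
        \<le> \<bar>y\<bar> ^ k / ((2 * \<bar>y\<bar> + 1) ^ k / A powr (1 - \<beta>) * exp (- A))"
      by (intro divide_left_mono mult_pos_pos[OF _ \<open>0 < (2 * \<bar>y\<bar> + 1) ^ k / A powr (1 - \<beta>) * exp (- A)\<close>]) simp_all
    also have "\<dots> = A powr (1 - \<beta>) * exp A * q ^ k"
      using A by (simp add: q_def power_divide exp_minus field_simps)
    finally show ?case using elim by (simp add: power_abs Gamma_real_pos)
  qed
  then show ?thesis
    by (rule summable_comparison_test_ev) (use q in \<open>auto intro!: summable_mult summable_geometric\<close>)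
qed

text \<open>The substitution \<open>s = t * u\<close> reduces this to Euler's Beta integral. It is
  the semigroup law of fractional integration: under convolution the orders of the kernels
  \<open>s powr (p - 1) / Gamma p\<close> add up.\<close>

lemma nn_integral_Beta_interval:
  fixes p q t :: real
  assumes p: "0 < p" and q: "0 < q" and t: "0 < t"
  shows "(\<integral>\<^sup>+s. ennreal (indicator {0<..<t} s * (s powr (p - 1) / Gamma p * ((t - s) powr (q - 1) / Gamma q))) \<partial>lborel)
     = ennreal (t powr (p + q - 1) / Gamma (p + q))" (is "?L = _")
proof -
  note G = Gamma_real_pos[OF p] Gamma_real_pos[OF q]
  have "?L = ennreal \<bar>t\<bar> * (\<integral>\<^sup>+u. ennreal (indicator {0<..<t} (0 + t * u) *
      ((0 + t * u) powr (p - 1) / Gamma p * ((t - (0 + t * u)) powr (q - 1) / Gamma q))) \<partial>lborel)"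
    using t by (intro nn_integral_real_affine) auto
  also have "(\<integral>\<^sup>+u. ennreal (indicator {0<..<t} (0 + t * u) *
      ((0 + t * u) powr (p - 1) / Gamma p * ((t - (0 + t * u)) powr (q - 1) / Gamma q))) \<partial>lborel)
     = (\<integral>\<^sup>+u. ennreal (t powr (p + q - 2) / (Gamma p * Gamma q)) *
          ennreal (indicator {0..1} u * (u powr (p - 1) * (1 - u) powr (q - 1))) \<partial>lborel)"
  proof (rule nn_integral_cong)
    fix u :: real
    show "ennreal (indicator {0<..<t} (0 + t * u) *
      ((0 + t * u) powr (p - 1) / Gamma p * ((t - (0 + t * u)) powr (q - 1) / Gamma q)))
      = ennreal (t powr (p + q - 2) / (Gamma p * Gamma q)) *
          ennreal (indicator {0..1} u * (u powr (p - 1) * (1 - u) powr (q - 1)))"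
    proof (cases "0 < u \<and> u < 1")
      case True
      have "t - t * u = t * (1 - u)" by (simp add: algebra_simps)
      moreover have "t powr (p + q - 2) = t powr (p - 1) * t powr (q - 1)"
        by (simp add: powr_add[symmetric])
      ultimately show ?thesis using True t G
        by (simp add: powr_mult ennreal_mult[symmetric] mult_ac)
    next
      \<comment> \<open>The indicator on the left is open and the one on the right closed; they
        agree at the end points because \<open>0 powr\<close> any exponent is 0.\<close>
      case False
      then consider "u \<le> 0" | "1 \<le> u" by linarith
      then show ?thesis
      proof cases
        case 1
        then have "t * u \<le> 0" using t by (simp add: mult_nonneg_nonpos)
        with 1 show ?thesis by (cases "u = 0") auto
      next
        case 2
        then have "t \<le> t * u" using t by simp
        with 2 show ?thesis by (cases "u = 1") auto
      qed
    qed
  qed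
  also have "\<dots> = ennreal (t powr (p + q - 2) / (Gamma p * Gamma q)) * ennreal (Beta p q)"
  proof (subst nn_integral_cmult)
    show "ennreal (t powr (p + q - 2) / (Gamma p * Gamma q)) *
       (\<integral>\<^sup>+u. ennreal (indicator {0..1} u * (u powr (p - 1) * (1 - u) powr (q - 1))) \<partial>lborel)
       = ennreal (t powr (p + q - 2) / (Gamma p * Gamma q)) * ennreal (Beta p q)"
      using nn_integral_has_integral_lebesgue[OF _ has_integral_Beta_real[OF p q]] by simp
  qed measurable
  also have "ennreal \<bar>t\<bar> * \<dots> = ennreal (t * (t powr (p + q - 2) / (Gamma p * Gamma q) * Beta p q))"
    using t G Gamma_real_pos[of "p + q"] p q by (simp add: ennreal_mult[symmetric] Beta_def)
  also have "t * (t powr (p + q - 2) / (Gamma p * Gamma q) * Beta p q) = t powr (p + q - 1) / Gamma (p + q)"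
  proof -
    have "t powr (p + q - 1) = t powr (1 + (p + q - 2))" by (simp add: algebra_simps)
    also have "\<dots> = t * t powr (p + q - 2)" using t by (subst powr_add) simp
    finally show ?thesis using G by (simp add: Beta_def)
  qed
  finally show ?thesis .
qed

lemma powr_affine_Suc:
  fixes s :: real
  assumes "0 < s"
  shows "s powr (\<kappa> * real (Suc k) + c) = s powr (\<kappa> + c) * (s powr \<kappa>) ^ k"
proof -
  have "(s powr \<kappa>) ^ k = s powr (\<kappa> * real k)"
    using assms by (subst powr_realpow[symmetric]) (simp_all add: powr_powr)
  moreover have "\<kappa> * real (Suc k) + c = (\<kappa> + c) + \<kappa> * real k" by (simp add: algebra_simps)
  ultimately show ?thesis by (simp only: powr_add)
qed

text \<open>Regrouped in this way, \<open>f_al\<close> is a Neumann series: the term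
  \<open>k\<close> is \<open>lm ^ Suc k\<close> times the kernel of the fractional integral of order
  \<open>\<alpha> * real (Suc k)\<close>, so further fractional integration acts term by
  term.\<close>

lemma f_al_sums:
  assumes "0 < \<alpha>" "0 < lm" "0 < s"
  shows "(\<lambda>k. lm ^ Suc k * (s powr (\<alpha> * real (Suc k) - 1) / Gamma (\<alpha> * real (Suc k)))) sums f_al \<alpha> lm s"
proof -
  have "(\<lambda>k. (lm * s powr \<alpha>) ^ k / Gamma (\<alpha> * real k + \<alpha>)) sums mittag_leffler \<alpha> \<alpha> (lm * s powr \<alpha>)"
    unfolding mittag_leffler_def using assms by (intro summable_sums summable_mittag_leffler)
  then have "(\<lambda>k. lm * s powr (\<alpha> - 1) * ((lm * s powr \<alpha>) ^ k / Gamma (\<alpha> * real k + \<alpha>)))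
      sums f_al \<alpha> lm s"
    using sums_mult[of _ _ "lm * s powr (\<alpha> - 1)"] assms by (simp only: f_al_def if_True)
  moreover have "s powr (\<alpha> * real (Suc k) - 1) = s powr (\<alpha> - 1) * (s powr \<alpha>) ^ k" for k
    using powr_affine_Suc[OF assms(3), of \<alpha> k "-1"] by simp
  then have "(\<lambda>k. lm ^ Suc k * (s powr (\<alpha> * real (Suc k) - 1) / Gamma (\<alpha> * real (Suc k))))
      = (\<lambda>k. lm * s powr (\<alpha> - 1) * ((lm * s powr \<alpha>) ^ k / Gamma (\<alpha> * real k + \<alpha>)))"
    by (simp only: power_mult_distrib) (simp add: distrib_left add.commute mult_ac)
  ultimately show ?thesis by (simp only:)
qed

lemma f_al_nonneg:
  assumes "0 < \<alpha>" "0 < lm"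
  shows "0 \<le> f_al \<alpha> lm s"
proof (cases "0 < s")
  case True
  have "0 \<le> lm ^ Suc k * (s powr (\<alpha> * real (Suc k) - 1) / Gamma (\<alpha> * real (Suc k)))" for k
    using assms by (intro mult_nonneg_nonneg divide_nonneg_nonneg Gamma_real_nonneg) auto
  from sums_le[OF this sums_zero f_al_sums[OF assms True]] show ?thesis .
qed (simp add: f_al_def)

lemma borel_measurable_f_al [measurable]: "f_al \<alpha> lm \<in> borel_measurable borel"
  unfolding f_al_def [abs_def] mittag_leffler_def by measurable

text \<open>The Beta integral is applied to each term of the series; all terms are nonnegative, so
  monotone convergence exchanges sum and integral and gives integrability as well. The orders 1 and
  \<open>1 - \<alpha>\<close> are the ones that occur in the limit kernel.\<close>

lemma f_al_fractional_integral:
  assumes \<alpha>: "0 < \<alpha>" and lm: "0 < lm" and \<beta>: "0 < \<beta>" and t: "0 < t"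
  shows "has_bochner_integral lborel
     (\<lambda>s. indicator {0<..<t} s * (f_al \<alpha> lm s * ((t - s) powr (\<beta> - 1) / Gamma \<beta>)))
     (\<Sum>k. lm ^ Suc k * (t powr (\<alpha> * real (Suc k) + \<beta> - 1) / Gamma (\<alpha> * real (Suc k) + \<beta>)))"
    (is "has_bochner_integral _ ?f (\<Sum>k. ?c k)")
    and "summable (\<lambda>k. lm ^ Suc k * (t powr (\<alpha> * real (Suc k) + \<beta> - 1) / Gamma (\<alpha> * real (Suc k) + \<beta>)))"
proof -
  have c0: "0 \<le> ?c k" for k
    using lm \<alpha> \<beta>
    by (intro mult_nonneg_nonneg divide_nonneg_nonneg Gamma_real_nonneg add_nonneg_pos) auto
  have "summable (\<lambda>k. lm * t powr (\<alpha> + \<beta> - 1) * ((lm * t powr \<alpha>) ^ k / Gamma (\<alpha> * real k + (\<alpha> + \<beta>))))"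
    using \<alpha> \<beta> by (intro summable_mult summable_mittag_leffler) auto
  moreover have "t powr (\<alpha> * real (Suc k) + \<beta> - 1) = t powr (\<alpha> + \<beta> - 1) * (t powr \<alpha>) ^ k" for k
    using powr_affine_Suc[OF t, of \<alpha> k "\<beta> - 1"] by (simp add: add_diff_eq)
  then have "?c = (\<lambda>k. lm * t powr (\<alpha> + \<beta> - 1) * ((lm * t powr \<alpha>) ^ k / Gamma (\<alpha> * real k + (\<alpha> + \<beta>))))"
    by (simp only: power_mult_distrib) (simp add: distrib_left add_ac mult_ac)
  ultimately show sc: "summable ?c" by (simp only:)
  let ?g = "\<lambda>k s. indicator {0<..<t} s * (s powr (\<alpha> * real (Suc k) - 1) / Gamma (\<alpha> * real (Suc k)) *
      ((t - s) powr (\<beta> - 1) / Gamma \<beta>))"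
  have fg: "ennreal (?f s) = (\<Sum>k. ennreal (lm ^ Suc k) * ennreal (?g k s))" for s
  proof (cases "0 < s \<and> s < t")
    case True
    have g0: "0 \<le> ?g k s" for k using \<alpha> \<beta> by (auto intro!: mult_nonneg_nonneg divide_nonneg_nonneg Gamma_real_nonneg)
    have "(\<lambda>k. lm ^ Suc k * ?g k s) sums ?f s"
      using sums_mult2[OF f_al_sums[OF \<alpha> lm, of s], of "(t - s) powr (\<beta> - 1) / Gamma \<beta>"] True
      by (simp add: algebra_simps)
    then have "(\<Sum>k. ennreal (lm ^ Suc k * ?g k s)) = ennreal (?f s)"
      using lm by (intro suminf_ennreal_eq mult_nonneg_nonneg g0) auto
    moreover have "ennreal (lm ^ Suc k * ?g k s) = ennreal (lm ^ Suc k) * ennreal (?g k s)" for k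
      using lm by (intro ennreal_mult') simp
    ultimately show ?thesis by (simp only:)
  qed auto
  have gm: "(\<lambda>s. ennreal (lm ^ Suc k) * ennreal (?g k s)) \<in> borel_measurable lborel" for k
    by measurable
  have "(\<integral>\<^sup>+s. ennreal (?f s) \<partial>lborel) = (\<integral>\<^sup>+s. (\<Sum>k. ennreal (lm ^ Suc k) * ennreal (?g k s)) \<partial>lborel)"
    by (rule nn_integral_cong) (rule fg)
  also have "\<dots> = (\<Sum>k. \<integral>\<^sup>+s. ennreal (lm ^ Suc k) * ennreal (?g k s) \<partial>lborel)"
    by (rule nn_integral_suminf[OF gm])
  also have "\<dots> = (\<Sum>k. ennreal (?c k))"
  proof (rule suminf_cong)
    fix k
    have "(\<integral>\<^sup>+s. ennreal (lm ^ Suc k) * ennreal (?g k s) \<partial>lborel)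
        = ennreal (lm ^ Suc k) * (\<integral>\<^sup>+s. ennreal (?g k s) \<partial>lborel)"
      by (rule nn_integral_cmult) measurable
    also have "(\<integral>\<^sup>+s. ennreal (?g k s) \<partial>lborel)
        = ennreal (t powr (\<alpha> * real (Suc k) + \<beta> - 1) / Gamma (\<alpha> * real (Suc k) + \<beta>))"
      using \<alpha> \<beta> t by (intro nn_integral_Beta_interval) auto
    also have "ennreal (lm ^ Suc k) * \<dots> = ennreal (?c k)"
      using lm by (intro ennreal_mult'[symmetric]) auto
    finally show "(\<integral>\<^sup>+s. ennreal (lm ^ Suc k) * ennreal (?g k s) \<partial>lborel) = ennreal (?c k)" .
  qed
  also have "\<dots> = ennreal (\<Sum>k. ?c k)" by (rule suminf_ennreal2[OF c0 sc])
  finally show "has_bochner_integral lborel ?f (\<Sum>k. ?c k)"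
    using f_al_nonneg[OF \<alpha> lm] \<beta>
    by (intro has_bochner_integral_nn_integral suminf_nonneg[OF sc c0] AE_I2
        mult_nonneg_nonneg divide_nonneg_nonneg Gamma_real_nonneg) auto
qed

text \<open>Both kernels are cut off to the unit interval, which makes them integrable on the line without
  changing convolutions with paths on \<^term>\<open>{0..1::real}\<close>. Since the Laplace transforms of
  \<open>f_al \<alpha> lm\<close> and of \<open>w powr (- \<alpha>) / Gamma (1 - \<alpha>) - lm\<close> are \<open>lm / (z powr \<alpha> - lm)\<close> and
  \<open>(z powr \<alpha> - lm) / z\<close>, their convolution is the constant \<open>lm\<close>.\<close>

definition ml_kernel :: "real \<Rightarrow> real \<Rightarrow> real \<Rightarrow> real" where
  "ml_kernel \<alpha> lm s = indicator {0<..<1} s * f_al \<alpha> lm s"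

definition frac_kernel :: "real \<Rightarrow> real \<Rightarrow> real \<Rightarrow> real" where
  "frac_kernel \<alpha> lm w = indicator {0<..1} w * (w powr (- \<alpha>) / Gamma (1 - \<alpha>) - lm)"

text \<open>This is the fractional integral of order \<open>\<beta> = 1\<close> at time 1, whose
  kernel is constantly 1 on the open unit interval.\<close>

lemma integrable_ml_kernel:
  assumes \<alpha>: "0 < \<alpha>" and lm: "0 < lm"
  shows "integrable lborel (ml_kernel \<alpha> lm)"
proof -
  have "integrable lborel (\<lambda>s. indicator {0<..<1} s * (f_al \<alpha> lm s * ((1 - s) powr (1 - 1) / Gamma 1)))"
    using f_al_fractional_integral(1)[OF \<alpha> lm, of 1 1] by (simp only: has_bochner_integral_iff)
  also have "(\<lambda>s. indicator {0<..<1} s * (f_al \<alpha> lm s * ((1 - s) powr (1 - 1) / Gamma 1))) = ml_kernel \<alpha> lm"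
    by (auto simp: ml_kernel_def fun_eq_iff indicator_def)
  finally show ?thesis .
qed

text \<open>The two series telescope: \<open>lm\<close> times the term \<open>k\<close> for order 1
  is the term \<open>Suc k\<close> for order \<open>1 - \<alpha>\<close>. Only the head remains, and
  there the exponent of \<open>t\<close> is 0. For \<open>t \<le> 1\<close> the cut-offs of the
  kernels do not interfere.\<close>

lemma conv_ml_frac_kernel:
  assumes \<alpha>: "0 < \<alpha>" "\<alpha> < 1" and lm: "0 < lm" and t: "0 < t" "t \<le> 1"
  shows "conv (ml_kernel \<alpha> lm) (frac_kernel \<alpha> lm) t = lm"
proof -
  let ?c = "\<lambda>\<beta> k. lm ^ Suc k * (t powr (\<alpha> * real (Suc k) + \<beta> - 1) / Gamma (\<alpha> * real (Suc k) + \<beta>))"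
  let ?f = "\<lambda>\<beta> s. indicator {0<..<t} s * (f_al \<alpha> lm s * ((t - s) powr (\<beta> - 1) / Gamma \<beta>))"
  have h: "has_bochner_integral lborel (?f (1 - \<alpha>)) (\<Sum>k. ?c (1 - \<alpha>) k)"
    "has_bochner_integral lborel (?f 1) (\<Sum>k. ?c 1 k)"
    and s: "summable (?c (1 - \<alpha>))" "summable (?c 1)"
    by (rule f_al_fractional_integral[OF \<alpha>(1) lm _ t(1)]; use \<alpha> in simp)+
  have "ml_kernel \<alpha> lm s * frac_kernel \<alpha> lm (t - s) = ?f (1 - \<alpha>) s - lm * ?f 1 s" for s
    using t by (auto simp: ml_kernel_def frac_kernel_def indicator_def algebra_simps)
  then have "conv (ml_kernel \<alpha> lm) (frac_kernel \<alpha> lm) t = (LINT s|lborel. ?f (1 - \<alpha>) s - lm * ?f 1 s)"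
    by (simp add: conv_def)
  also have "\<dots> = (\<Sum>k. ?c (1 - \<alpha>) k) - lm * (\<Sum>k. ?c 1 k)"
    using h by (intro has_bochner_integral_integral_eq has_bochner_integral_diff has_bochner_integral_mult_right)
  also have "lm * (\<Sum>k. ?c 1 k) = (\<Sum>k. ?c (1 - \<alpha>) (Suc k))"
    by (subst suminf_mult[OF s(2), symmetric]) (simp add: algebra_simps)
  also have "(\<Sum>k. ?c (1 - \<alpha>) k) - (\<Sum>k. ?c (1 - \<alpha>) (Suc k)) = ?c (1 - \<alpha>) 0"
    using suminf_split_head[OF s(1)] by simp
  also have "?c (1 - \<alpha>) 0 = lm" using t by simp
  finally show ?thesis .
qed

section \<open>The renewal kernel of a heavy-tailed density\<close>

abbreviation unit_ind :: "real \<Rightarrow> real" where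
  "unit_ind \<equiv> indicator {0..1}"

lemma integrable_unit_ind: "integrable lborel unit_ind"
  by (simp add: integrable_indicator_iff)

text \<open>The singularity at 0 is controlled by the Beta integral with
  \<open>p = 1 - \<alpha>\<close> and \<open>q = 1\<close>. The second form serves as part of a
  dominating function for the renewal kernels.\<close>

lemma integrable_frac_kernel:
  assumes \<alpha>: "\<alpha> < 1"
  shows "integrable lborel (frac_kernel \<alpha> lm)"
    and "integrable lborel (\<lambda>w. indicator {0<..1} w * w powr (- \<alpha>))"
proof -
  have "integrable lborel (\<lambda>s. indicator {0<..<1} s * (s powr ((1 - \<alpha>) - 1) / Gamma (1 - \<alpha>) * ((1 - s) powr (1 - 1) / Gamma 1)))"
    using nn_integral_Beta_interval[of "1 - \<alpha>" 1 1] \<alpha>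
    by (intro integrableI_nonneg) (auto intro!: AE_I2 mult_nonneg_nonneg divide_nonneg_nonneg Gamma_real_nonneg)
  then have "integrable lborel (\<lambda>s. Gamma (1 - \<alpha>) * (indicator {0<..<1} s * (s powr ((1 - \<alpha>) - 1) / Gamma (1 - \<alpha>) * ((1 - s) powr (1 - 1) / Gamma 1))))"
    by (rule integrable_mult_right)
  moreover have "AE s in lborel. Gamma (1 - \<alpha>) * (indicator {0<..<1} s * (s powr ((1 - \<alpha>) - 1) / Gamma (1 - \<alpha>) * ((1 - s) powr (1 - 1) / Gamma 1)))
     = indicator {0<..1} s * s powr (- \<alpha>)"
    using AE_lborel_singleton[of 1]
  proof eventually_elim
    case (elim s)
    have "0 < Gamma (1 - \<alpha>)" using \<alpha> by (intro Gamma_real_pos) simp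
    with elim show ?case by (auto simp: indicator_def)
  qed
  ultimately show i: "integrable lborel (\<lambda>w. indicator {0<..1} w * w powr (- \<alpha>))"
    by (subst integrable_cong_AE[symmetric]) auto
  have "integrable lborel (\<lambda>w. (indicator {0<..1} w * w powr (- \<alpha>)) / Gamma (1 - \<alpha>) - lm * indicator {0<..1} w)"
    by (intro Bochner_Integration.integrable_diff integrable_divide i integrable_mult_right)
      (simp add: integrable_indicator_iff)
  then show "integrable lborel (frac_kernel \<alpha> lm)"
    by (rule back_subst[of "integrable lborel"])
      (auto simp: frac_kernel_def fun_eq_iff indicator_def)
qed

text \<open>By associativity the convolution of the two kernels may be formed before it meets the
  path; it equals \<open>lm\<close> on the range of lags that the path can see.\<close>

lemma ml_kernel_conv_frac_kernel_conv:
  assumes \<alpha>: "0 < \<alpha>" "\<alpha> < 1" and lm: "0 < lm" and t: "t \<le> 1"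
    and x[measurable]: "x \<in> borel_measurable borel" and b: "\<And>s. \<bar>x s\<bar> \<le> B"
    and sx: "\<And>s. s \<notin> {0..1} \<Longrightarrow> x s = 0"
  shows "conv (ml_kernel \<alpha> lm) (conv (frac_kernel \<alpha> lm) x) t = lm * conv unit_ind x t"
proof -
  have i: "integrable lborel (ml_kernel \<alpha> lm)" "integrable lborel (frac_kernel \<alpha> lm)"
    using \<alpha> lm by (auto intro: integrable_ml_kernel integrable_frac_kernel)
  have [measurable]: "ml_kernel \<alpha> lm \<in> borel_measurable borel" "frac_kernel \<alpha> lm \<in> borel_measurable borel"
    using i by (auto dest: borel_measurable_integrable)
  have "conv (ml_kernel \<alpha> lm) (conv (frac_kernel \<alpha> lm) x) t
      = conv (conv (ml_kernel \<alpha> lm) (frac_kernel \<alpha> lm)) x t"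
    by (rule conv_assoc[OF i x b, symmetric])
  also have "\<dots> = (LINT s|lborel. lm * (unit_ind s * x (t - s)))"
    unfolding conv_def[of _ x]
  proof (rule integral_cong_AE)
    show "AE s in lborel. conv (ml_kernel \<alpha> lm) (frac_kernel \<alpha> lm) s * x (t - s) = lm * (unit_ind s * x (t - s))"
      using AE_lborel_singleton[of 0]
    proof eventually_elim
      case (elim s)
      consider "s < 0" | "0 < s" "s \<le> 1" | "1 < s" using elim by linarith
      then show ?case
      proof cases
        case 1
        then have "ml_kernel \<alpha> lm r * frac_kernel \<alpha> lm (s - r) = 0" for r
          by (auto simp: ml_kernel_def frac_kernel_def indicator_def)
        then show ?thesis using 1 by (simp only: conv_def) simp
      next
        case 2
        then show ?thesis by (simp add: conv_ml_frac_kernel \<alpha> lm)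
      next
        \<comment> \<open>Past 1 the truncated kernels no longer convolve to a constant, but such
          lags look at the path before time 0.\<close>
        case 3
        then have "x (t - s) = 0" using t by (intro sx) auto
        then show ?thesis by simp
      qed
    qed
  qed measurable
  also have "\<dots> = lm * conv unit_ind x t" by (simp add: conv_def)
  finally show ?thesis .
qed

locale heavy_tail =
  fixes \<phi> :: "real \<Rightarrow> real" and \<alpha> K :: real
  assumes phi_meas: "\<phi> \<in> borel_measurable lborel"
    and phi_nonneg: "\<forall>t\<ge>0. \<phi> t \<ge> 0"
    and phi_int: "set_integrable lborel {0..} \<phi>"
    and phi_one: "(LINT t:{0..}|lborel. \<phi> t) = 1"
    and alpha: "0 < \<alpha>" "\<alpha> < 1"
    and K_pos: "K > 0"
    and tail: "((\<lambda>x. \<alpha> * x powr \<alpha> * (1 - (LINT t:{0..x}|lborel. \<phi> t))) \<longlongrightarrow> K) at_top"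
begin

lemma phi_borel [measurable]: "\<phi> \<in> borel_measurable borel"
  using phi_meas by simp

definition cdf_phi :: "real \<Rightarrow> real" where
  "cdf_phi x = (LINT t:{0..x}|lborel. \<phi> t)"

lemma set_integrable_phi: "set_integrable lborel {0..x} \<phi>"
  by (rule set_integrable_subset[OF phi_int]) auto

lemma cdf_phi_mono: "x \<le> y \<Longrightarrow> cdf_phi x \<le> cdf_phi y"
  unfolding cdf_phi_def using set_integrable_phi phi_nonneg
  by (auto simp: set_lebesgue_integral_def set_integrable_def indicator_def intro!: integral_mono)

lemma cdf_phi_le_1: "cdf_phi x \<le> 1"
  unfolding cdf_phi_def phi_one[symmetric] using set_integrable_phi phi_nonneg phi_int
  by (auto simp: set_lebesgue_integral_def set_integrable_def indicator_def intro!: integral_mono)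

lemma cdf_phi_nonneg: "0 \<le> cdf_phi x"
  unfolding cdf_phi_def using phi_nonneg
  by (auto simp: set_lebesgue_integral_def indicator_def intro!: integral_nonneg)

lemma borel_measurable_cdf_phi [measurable]: "cdf_phi \<in> borel_measurable borel"
  by (intro borel_measurable_mono monoI cdf_phi_mono)

definition \<delta> :: real where "\<delta> = K * Gamma (1 - \<alpha>) / \<alpha>"

lemma delta_pos: "0 < \<delta>"
  using alpha K_pos by (simp add: \<delta>_def Gamma_real_pos)

text \<open>The factor \<open>Gamma (1 - \<alpha>)\<close> in \<delta> cancels the normalisation of
  the fractional kernel, which leaves exactly the limit of the scaled tail.\<close>

lemma delta_frac_kernel:
  "\<delta> * frac_kernel \<alpha> lm w = indicator {0<..1} w * (K / \<alpha> * w powr (- \<alpha>) - lm * \<delta>)"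
proof -
  have "0 < Gamma (1 - \<alpha>)" using alpha by (intro Gamma_real_pos) simp
  then have "\<delta> * (w powr (- \<alpha>) / Gamma (1 - \<alpha>)) = K / \<alpha> * w powr (- \<alpha>)"
    by (simp add: \<delta>_def)
  then show ?thesis by (auto simp: frac_kernel_def right_diff_distrib indicator_def)
qed

text \<open>The tail assumption controls large \<open>x\<close> only; below the threshold
  \<open>x0\<close> the tail is at most 1 and the power at most
  \<open>\<bar>x0\<bar> powr \<alpha>\<close>. A bound for all \<open>x\<close> at once is what
  becomes uniform in \<open>n\<close> after rescaling.\<close>

lemma tail_bound: "\<exists>C. \<forall>x>0. x powr \<alpha> * (1 - cdf_phi x) \<le> C"
proof -
  have "eventually (\<lambda>x. \<alpha> * x powr \<alpha> * (1 - cdf_phi x) < K + 1) at_top"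
    using order_tendstoD(2)[OF tail, of "K + 1"] by (simp add: cdf_phi_def)
  then obtain x0 where x0: "\<And>x. x \<ge> x0 \<Longrightarrow> \<alpha> * x powr \<alpha> * (1 - cdf_phi x) < K + 1"
    by (auto simp: eventually_at_top_linorder)
  have "x powr \<alpha> * (1 - cdf_phi x) \<le> (K + 1) / \<alpha> + \<bar>x0\<bar> powr \<alpha>" if "0 < x" for x
  proof (cases "x \<ge> x0")
    case True
    have "x powr \<alpha> * (1 - cdf_phi x) \<le> (K + 1) / \<alpha>"
      using x0[OF True] alpha by (simp add: field_simps)
    then show ?thesis by (simp add: add_increasing2)
  next
    case False
    have "x powr \<alpha> * (1 - cdf_phi x) \<le> \<bar>x0\<bar> powr \<alpha> * 1"
      using False that alpha cdf_phi_nonneg cdf_phi_le_1 by (intro mult_mono powr_mono2) auto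
    then show ?thesis using K_pos alpha by (simp add: add_increasing)
  qed
  then show ?thesis by blast
qed

lemma scaled_tail_lim:
  assumes "0 < w"
  shows "(\<lambda>n. real n powr \<alpha> * (1 - cdf_phi (real n * w))) \<longlonglongrightarrow> K / \<alpha> * w powr (- \<alpha>)"
proof -
  have "filterlim (\<lambda>n. real n * w) at_top sequentially" using assms by real_asymp
  from filterlim_compose[OF tail this]
  have "(\<lambda>n. \<alpha> * (real n * w) powr \<alpha> * (1 - cdf_phi (real n * w))) \<longlonglongrightarrow> K"
    by (simp add: cdf_phi_def)
  then have "(\<lambda>n. \<alpha> * (real n * w) powr \<alpha> * (1 - cdf_phi (real n * w)) * (w powr (- \<alpha>) / \<alpha>)) \<longlonglongrightarrow> K * (w powr (- \<alpha>) / \<alpha>)"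
    by (intro tendsto_intros)
  moreover have "\<alpha> * (real n * w) powr \<alpha> * (1 - cdf_phi (real n * w)) * (w powr (- \<alpha>) / \<alpha>)
      = real n powr \<alpha> * (1 - cdf_phi (real n * w))" for n
    using assms alpha by (simp add: powr_mult powr_minus field_simps)
  ultimately show ?thesis by simp
qed

section \<open>The density after rescaling of time, and its integrated renewal kernel\<close>

definition scaled_phi :: "nat \<Rightarrow> real \<Rightarrow> real" where
  "scaled_phi n v = unit_ind v * (real n * \<phi> (real n * v))"

lemma integrable_scaled_phi: "integrable lborel (scaled_phi n)"
proof (cases "n = 0")
  case False
  have "integrable lborel (\<lambda>v. indicator {0..real n} v * \<phi> v)"
    using set_integrable_phi[of "real n"] by (simp add: set_integrable_def)
  from lborel_integrable_real_affine[OF this, of "real n" 0]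
  have "integrable lborel (\<lambda>v. real n * (indicator {0..real n} (real n * v) * \<phi> (real n * v)))"
    using False by (intro integrable_mult_right) simp
  then show ?thesis
    by (rule back_subst[of "integrable lborel"])
      (use False in \<open>auto simp: scaled_phi_def fun_eq_iff indicator_def zero_le_mult_iff mult_le_cancel_left1\<close>)
qed (simp add: scaled_phi_def [abs_def])

lemma scaled_phi_nonneg: "0 \<le> scaled_phi n v"
  using phi_nonneg by (simp add: scaled_phi_def indicator_def)

lemma conv_unit_scaled_phi:
  assumes n: "0 < n" and w: "0 \<le> w" "w \<le> 1"
  shows "conv unit_ind (scaled_phi n) w = cdf_phi (real n * w)"
proof -
  have "cdf_phi (real n * w) = real n * (LINT v|lborel. indicator {0..real n * w} (real n * v) * \<phi> (real n * v))"
    using n lborel_integral_real_affine[of "real n" "\<lambda>v. indicator {0..real n * w} v * \<phi> v" 0]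
    by (simp add: cdf_phi_def set_lebesgue_integral_def)
  also have "\<dots> = (LINT v|lborel. scaled_phi n v * unit_ind (w - v))"
    unfolding integral_mult_right_zero[symmetric]
    by (intro Bochner_Integration.integral_cong refl)
      (use n w in \<open>auto simp: scaled_phi_def indicator_def zero_le_mult_iff mult_le_cancel_left_pos\<close>)
  finally show ?thesis by (simp only: conv_def[symmetric] conv_commute[of unit_ind])
qed

lemma conv_unit_scaled_phi_neg: "w < 0 \<Longrightarrow> conv unit_ind (scaled_phi n) w = 0"
proof -
  assume "w < 0"
  then have "(\<lambda>s. unit_ind s * scaled_phi n (w - s)) = (\<lambda>_. 0)"
    by (auto simp: scaled_phi_def indicator_def fun_eq_iff)
  then show ?thesis by (simp add: conv_def)
qed

text \<open>This is the primitive of \<open>n powr \<alpha>\<close> times the Dirac mass at 0 minus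
  \<open>a\<close> times the rescaled density: the Dirac mass integrates to 1, the density to
  \<open>cdf_phi (real n * w)\<close>.\<close>

definition renewal_kernel :: "real \<Rightarrow> nat \<Rightarrow> real \<Rightarrow> real" where
  "renewal_kernel a n w = unit_ind w * (real n powr \<alpha> * (1 - a * cdf_phi (real n * w)))"

lemma borel_measurable_renewal_kernel [measurable]: "renewal_kernel a n \<in> borel_measurable borel"
  unfolding renewal_kernel_def [abs_def] by measurable

text \<open>Separates the heavy tail from the distance to criticality: both summands have finite
  limits, whereas \<open>n powr \<alpha>\<close> itself diverges.\<close>

lemma renewal_kernel_eq:
  "renewal_kernel a n w = unit_ind w * (a * (real n powr \<alpha> * (1 - cdf_phi (real n * w))) - real n powr \<alpha> * (a - 1))"
  by (simp add: renewal_kernel_def algebra_simps)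

lemma integrable_renewal_kernel: "integrable lborel (renewal_kernel a n)"
proof (rule Bochner_Integration.integrable_bound)
  show "integrable lborel (\<lambda>w. (real n powr \<alpha> * (1 + \<bar>a\<bar>)) * unit_ind w)"
    by (intro integrable_mult_right integrable_unit_ind)
  have "\<bar>1 - a * cdf_phi x\<bar> \<le> 1 + \<bar>a\<bar>" for x
  proof -
    have "\<bar>a * cdf_phi x\<bar> \<le> \<bar>a\<bar> * 1"
      unfolding abs_mult using cdf_phi_nonneg cdf_phi_le_1 by (intro mult_left_mono) auto
    then show ?thesis by linarith
  qed
  then show "AE w in lborel. norm (renewal_kernel a n w) \<le> norm ((real n powr \<alpha> * (1 + \<bar>a\<bar>)) * unit_ind w)"
    by (intro AE_I2) (auto simp: renewal_kernel_def abs_mult indicator_def intro!: mult_left_mono)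
qed measurable

text \<open>Dominated convergence. The tail bound at \<open>real n * w\<close>, multiplied by
  \<open>w powr (- \<alpha>)\<close>, gives a majorant that is free of \<open>n\<close> and
  integrable on the unit interval.\<close>

lemma renewal_kernel_lim:
  assumes a: "a \<longlonglongrightarrow> 1" and rate: "(\<lambda>n. real n powr \<alpha> * (a n - 1)) \<longlonglongrightarrow> lm * \<delta>"
  shows "(\<lambda>n. LINT w|lborel. \<bar>\<delta> * frac_kernel \<alpha> lm w - renewal_kernel (a n) n w\<bar>) \<longlonglongrightarrow> 0"
proof -
  obtain C where C: "\<And>x. 0 < x \<Longrightarrow> x powr \<alpha> * (1 - cdf_phi x) \<le> C" using tail_bound by blast
  obtain A where A: "\<And>n. \<bar>a n\<bar> \<le> A"
    using BseqD[OF convergent_imp_Bseq[OF convergentI[OF a]]] by auto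
  obtain R where R: "\<And>n. \<bar>real n powr \<alpha> * (a n - 1)\<bar> \<le> R"
    using BseqD[OF convergent_imp_Bseq[OF convergentI[OF rate]]] by auto
  have fk: "integrable lborel (frac_kernel \<alpha> lm)" and pw: "integrable lborel (\<lambda>w. indicator {0<..1} w * w powr (- \<alpha>))"
    using integrable_frac_kernel alpha by auto
  have "(\<lambda>n. LINT w|lborel. \<bar>\<delta> * frac_kernel \<alpha> lm w - renewal_kernel (a n) n w\<bar>) \<longlonglongrightarrow> (LINT w|(lborel::real measure). 0)"
  proof (rule integral_dominated_convergence[where
        w = "\<lambda>w. \<bar>\<delta> * frac_kernel \<alpha> lm w\<bar> + (A * C * (indicator {0<..1} w * w powr (- \<alpha>)) + R * unit_ind w)"])
    show "integrable lborel (\<lambda>w. \<bar>\<delta> * frac_kernel \<alpha> lm w\<bar> + (A * C * (indicator {0<..1} w * w powr (- \<alpha>)) + R * unit_ind w))"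
      by (intro Bochner_Integration.integrable_add integrable_abs integrable_mult_right fk pw integrable_unit_ind)
    have [measurable]: "frac_kernel \<alpha> lm \<in> borel_measurable borel" using fk by (auto dest: borel_measurable_integrable)
    show "(\<lambda>w. \<bar>\<delta> * frac_kernel \<alpha> lm w - renewal_kernel (a n) n w\<bar>) \<in> borel_measurable lborel" for n
      by measurable
    show "AE w in lborel. (\<lambda>n. \<bar>\<delta> * frac_kernel \<alpha> lm w - renewal_kernel (a n) n w\<bar>) \<longlonglongrightarrow> 0"
      \<comment> \<open>At \<open>w = 0\<close> the kernel equals \<open>n powr \<alpha>\<close> and
        diverges.\<close>
      using AE_lborel_singleton[of 0]
    proof eventually_elim
      case (elim w)
      show ?case
      proof (cases "0 < w \<and> w \<le> 1")
        case True
        have "(\<lambda>n. a n * (real n powr \<alpha> * (1 - cdf_phi (real n * w))) - real n powr \<alpha> * (a n - 1))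
            \<longlonglongrightarrow> 1 * (K / \<alpha> * w powr (- \<alpha>)) - lm * \<delta>"
          using True by (intro tendsto_intros a rate scaled_tail_lim) auto
        then have "(\<lambda>n. renewal_kernel (a n) n w) \<longlonglongrightarrow> \<delta> * frac_kernel \<alpha> lm w"
          using True by (simp add: renewal_kernel_eq delta_frac_kernel)
        from tendsto_rabs[OF tendsto_diff[OF tendsto_const[of "\<delta> * frac_kernel \<alpha> lm w"] this]]
        show ?thesis by simp
      next
        case False
        then have "renewal_kernel (a n) n w = 0" "frac_kernel \<alpha> lm w = 0" for n
          using elim by (auto simp: renewal_kernel_def frac_kernel_def indicator_def)
        then show ?thesis by simp
      qed
    qed
    show "AE w in lborel. norm \<bar>\<delta> * frac_kernel \<alpha> lm w - renewal_kernel (a n) n w\<bar>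
        \<le> \<bar>\<delta> * frac_kernel \<alpha> lm w\<bar> + (A * C * (indicator {0<..1} w * w powr (- \<alpha>)) + R * unit_ind w)" for n
      using AE_lborel_singleton[of 0]
    proof eventually_elim
      case (elim w)
      have "\<bar>renewal_kernel (a n) n w\<bar> \<le> A * C * (indicator {0<..1} w * w powr (- \<alpha>)) + R * unit_ind w"
      proof (cases "0 < w \<and> w \<le> 1")
        case True
        have T0: "0 \<le> 1 - cdf_phi (real n * w)" using cdf_phi_le_1 by simp
        have "real n powr \<alpha> * (1 - cdf_phi (real n * w)) \<le> C * w powr (- \<alpha>)"
        proof (cases "n = 0")
          \<comment> \<open>The majorant is demanded for every index, so \<open>n = 0\<close>
            occurs; the left side is then 0, and \<open>0 \<le> C\<close> is read off at
            \<open>x = 1\<close>.\<close>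
          case True
          have "0 \<le> C" using C[of 1] cdf_phi_le_1[of 1] by simp
          with True show ?thesis by simp
        next
          case False
          then have "(real n * w) powr \<alpha> * (1 - cdf_phi (real n * w)) \<le> C" using True by (intro C) auto
          then have "(real n * w) powr \<alpha> * (1 - cdf_phi (real n * w)) * w powr (- \<alpha>) \<le> C * w powr (- \<alpha>)"
            by (intro mult_right_mono) auto
          moreover have "(real n * w) powr \<alpha> * w powr (- \<alpha>) = real n powr \<alpha>"
            using True by (simp add: powr_mult powr_minus)
          ultimately show ?thesis by (simp add: mult_ac) (metis mult.commute mult.left_commute)
        qed
        moreover have "0 \<le> A" using A[of n] by linarith
        ultimately have "\<bar>a n * (real n powr \<alpha> * (1 - cdf_phi (real n * w)))\<bar> \<le> A * (C * w powr (- \<alpha>))"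
          unfolding abs_mult[of "a n"] using T0 by (intro mult_mono[OF A]) auto
        then show ?thesis using True R[of n] by (simp add: renewal_kernel_eq)
      next
        case False
        have "0 \<le> R" using R[of 0] by linarith
        with False elim show ?thesis by (auto simp: renewal_kernel_def indicator_def)
      qed
      then show ?case by simp
    qed
  qed simp
  then show ?thesis by simp
qed

end

section \<open>Pathwise renewal equation\<close>

text \<open>What one sample path off the exceptional null set provides. Monotonicity and right
  continuity make \<open>interval_measure z\<close> the Stieltjes measure of the path, and
  everything derived here is deterministic.\<close>

locale hawkes_path = heavy_tail +
  fixes z lam :: "real \<Rightarrow> real" and a \<mu> :: real
  assumes a_nonneg: "0 \<le> a" and mu_pos: "0 < \<mu>"
    and z_neg: "\<forall>t<0. z t = 0" and z_mono: "mono z"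
    and z_right: "\<forall>t. continuous (at_right t) z"
    and lam_meas: "lam \<in> borel_measurable lborel"
    and lam_eq: "\<forall>t\<ge>0. ennreal (lam t) =
      ennreal \<mu> + (\<integral>\<^sup>+ s\<in>{0..<t}. ennreal (a * \<phi> (t - s)) \<partial>interval_measure z)"
begin

lemma z_nonneg: "0 \<le> z t"
proof (cases "t < 0")
  case False
  then have "z (- 1) \<le> z t" by (intro monoD[OF z_mono]) simp
  then show ?thesis using z_neg by simp
qed (simp add: z_neg)

lemma borel_measurable_z [measurable]: "z \<in> borel_measurable borel"
  by (rule borel_measurable_mono[OF z_mono])

lemma borel_measurable_lam [measurable]: "lam \<in> borel_measurable borel"
  using lam_meas by simp

lemma sigma_finite_z: "sigma_finite_measure (interval_measure z)"
  by (rule sigma_finite_interval_measure) (use z_mono z_right in \<open>auto dest: monoD\<close>)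

text \<open>The path may jump at 0, and this atom belongs to \<open>{0..u}\<close>. It is caught by
  half-open intervals with left end points increasing to 0, where \<open>z\<close> still
  vanishes.\<close>

lemma emeasure_z: "0 \<le> u \<Longrightarrow> emeasure (interval_measure z) {0..u} = ennreal (z u)"
proof -
  assume u: "0 \<le> u"
  let ?A = "\<lambda>m::nat. {- 1 / (real m + 1)<..u}"
  have A: "emeasure (interval_measure z) (?A m) = ennreal (z u)" for m
  proof -
    have neg: "- 1 / (real m + 1) < 0" by simp
    then have "emeasure (interval_measure z) (?A m) = ennreal (z u - z (- 1 / (real m + 1)))"
      using u z_right z_mono by (intro emeasure_interval_measure_Ioc) (auto dest: monoD intro: order_trans[OF less_imp_le[OF neg]] simp del: divide_minus_left)
    then show ?thesis using neg z_neg by simp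
  qed
  have "(\<lambda>m. emeasure (interval_measure z) (?A m)) \<longlonglongrightarrow> emeasure (interval_measure z) (\<Inter>m. ?A m)"
  proof (rule Lim_emeasure_decseq)
    show "decseq ?A" by (force simp: decseq_def frac_le intro: order_le_less_trans[rotated])
    show "emeasure (interval_measure z) (?A m) \<noteq> \<infinity>" for m by (subst A) simp
  qed auto
  also have "(\<Inter>m. ?A m) = {0..u}"
  proof (intro equalityI subsetI)
    fix v assume v: "v \<in> (\<Inter>m. ?A m)"
    have "(\<lambda>m. - 1 / (real m + 1)) \<longlonglongrightarrow> 0" by real_asymp
    then have "0 \<le> v" by (rule LIMSEQ_le_const2) (use v in \<open>auto intro: less_imp_le\<close>)
    with v show "v \<in> {0..u}" by auto
  next
    fix v assume v: "v \<in> {0..u}"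
    have "- 1 / (real m + 1) < v" for m :: nat
      by (rule less_le_trans[of _ 0]) (use v in auto)
    with v show "v \<in> (\<Inter>m. ?A m)" by auto
  qed
  finally show ?thesis unfolding A by (rule LIMSEQ_unique[OF _ tendsto_const])
qed

lemma lam_pos: "0 \<le> t \<Longrightarrow> 0 \<le> lam t"
proof -
  assume "0 \<le> t"
  then have "ennreal \<mu> \<le> ennreal (lam t)" by (simp add: lam_eq)
  then show ?thesis using mu_pos by (metis ennreal_le_iff2 less_eq_real_def not_le order_trans)
qed

text \<open>Tonelli and the substitution \<open>t = s + v\<close> integrate out the Stieltjes
  measure: its mass of \<open>{0..T - v}\<close> is \<open>z (T - v)\<close>, so the integrated
  intensity contains an ordinary convolution of \<phi> with the path.\<close>

lemma nn_integral_lam: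
  assumes T: "0 \<le> T"
  shows "(\<integral>\<^sup>+t\<in>{0..T}. ennreal (lam t) \<partial>lborel)
    = ennreal (\<mu> * T) + (\<integral>\<^sup>+v\<in>{0..T}. ennreal (a * \<phi> v * z (T - v)) \<partial>lborel)"
proof -
  interpret Z: sigma_finite_measure "interval_measure z" by (rule sigma_finite_z)
  interpret P: pair_sigma_finite "interval_measure z" lborel ..
  have sZ [measurable_cong, simp]: "sets (interval_measure z) = sets borel" by simp
  let ?h = "\<lambda>s t. if 0 \<le> s \<and> s < t \<and> t \<le> T then ennreal (a * \<phi> (t - s)) else 0"
  let ?k = "\<lambda>s v. if 0 \<le> s \<and> 0 < v \<and> s + v \<le> T then ennreal (a * \<phi> v) else 0"
  have [measurable]: "(\<lambda>(s, t). ?h s t) \<in> borel_measurable (interval_measure z \<Otimes>\<^sub>M lborel)"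
    "(\<lambda>(s, t). ?k s t) \<in> borel_measurable (interval_measure z \<Otimes>\<^sub>M lborel)"
    by measurable
  have hm: "?h s \<in> borel_measurable lborel" for s by measurable
  have "(\<integral>\<^sup>+t\<in>{0..T}. ennreal (lam t) \<partial>lborel)
     = (\<integral>\<^sup>+t. ennreal \<mu> * indicator {0..T} t + (\<integral>\<^sup>+s. ?h s t \<partial>interval_measure z) \<partial>lborel)"
  proof (rule nn_integral_cong)
    fix t :: real
    show "ennreal (lam t) * indicator {0..T} t
       = ennreal \<mu> * indicator {0..T} t + (\<integral>\<^sup>+s. ?h s t \<partial>interval_measure z)"
    proof (cases "0 \<le> t \<and> t \<le> T")
      case True
      have "(\<integral>\<^sup>+ s\<in>{0..<t}. ennreal (a * \<phi> (t - s)) \<partial>interval_measure z) = (\<integral>\<^sup>+s. ?h s t \<partial>interval_measure z)"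
        using True by (intro nn_integral_cong) (auto simp: indicator_def)
      with True show ?thesis by (simp add: lam_eq)
    next
      case False
      then have "?h s t = 0" for s by auto
      with False show ?thesis by (auto simp: indicator_def)
    qed
  qed
  also have "\<dots> = (\<integral>\<^sup>+t. ennreal \<mu> * indicator {0..T} t \<partial>lborel) + (\<integral>\<^sup>+t. \<integral>\<^sup>+s. ?h s t \<partial>interval_measure z \<partial>lborel)"
    by (rule nn_integral_add) measurable
  also have "(\<integral>\<^sup>+t. ennreal \<mu> * indicator {0..T} t \<partial>lborel) = ennreal (\<mu> * T)"
    using T mu_pos by (simp add: nn_integral_cmult_indicator ennreal_mult)
  also have "(\<integral>\<^sup>+t. \<integral>\<^sup>+s. ?h s t \<partial>interval_measure z \<partial>lborel) = (\<integral>\<^sup>+s. \<integral>\<^sup>+t. ?h s t \<partial>lborel \<partial>interval_measure z)"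
    by (rule P.Fubini') measurable
  also have "\<dots> = (\<integral>\<^sup>+s. \<integral>\<^sup>+v. ?k s v \<partial>lborel \<partial>interval_measure z)"
  proof (rule nn_integral_cong)
    fix s
    have "(\<integral>\<^sup>+t. ?h s t \<partial>lborel) = ennreal \<bar>1\<bar> * (\<integral>\<^sup>+v. ?h s (s + 1 * v) \<partial>lborel)"
      by (rule nn_integral_real_affine) (use hm in auto)
    also have "(\<integral>\<^sup>+v. ?h s (s + 1 * v) \<partial>lborel) = (\<integral>\<^sup>+v. ?k s v \<partial>lborel)"
      by (rule nn_integral_cong) auto
    finally show "(\<integral>\<^sup>+t. ?h s t \<partial>lborel) = (\<integral>\<^sup>+v. ?k s v \<partial>lborel)" by simp
  qed
  also have "\<dots> = (\<integral>\<^sup>+v. \<integral>\<^sup>+s. ?k s v \<partial>interval_measure z \<partial>lborel)"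
    by (rule P.Fubini'[symmetric]) measurable
  also have "\<dots> = (\<integral>\<^sup>+v\<in>{0..T}. ennreal (a * \<phi> v * z (T - v)) \<partial>lborel)"
  \<comment> \<open>The half-open range \<open>s < t\<close> of the intensity equation has become
    \<open>0 < v\<close>; the point \<open>v = 0\<close> is Lebesgue null.\<close>
  proof (rule nn_integral_cong_AE, use AE_lborel_singleton[of 0] in eventually_elim)
    fix v :: real assume "v \<noteq> 0"
    show "(\<integral>\<^sup>+s. ?k s v \<partial>interval_measure z) = ennreal (a * \<phi> v * z (T - v)) * indicator {0..T} v"
    proof (cases "0 < v \<and> v \<le> T")
      case True
      have "(\<integral>\<^sup>+s. ?k s v \<partial>interval_measure z)
          = (\<integral>\<^sup>+s. ennreal (a * \<phi> v) * indicator {0..T - v} s \<partial>interval_measure z)"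
        using True by (intro nn_integral_cong) (auto simp: indicator_def)
      also have "\<dots> = ennreal (a * \<phi> v) * ennreal (z (T - v))"
        using True by (subst nn_integral_cmult_indicator) (auto simp: emeasure_z)
      finally show ?thesis using True a_nonneg phi_nonneg z_nonneg by (simp add: ennreal_mult)
    next
      case False
      then have "?k s v = 0" for s by auto
      with False \<open>v \<noteq> 0\<close> show ?thesis by (auto simp: indicator_def)
    qed
  qed
  finally show ?thesis .
qed

lemma integrable_phi_z: "integrable lborel (\<lambda>v. indicator {0..T} v * (\<phi> v * z (T - v)))"
proof (rule Bochner_Integration.integrable_bound)
  show "integrable lborel (\<lambda>v. z T * (indicator {0..T} v * \<phi> v))"
    using set_integrable_phi[of T] by (simp add: set_integrable_def)
  show "AE v in lborel. norm (indicator {0..T} v * (\<phi> v * z (T - v))) \<le> norm (z T * (indicator {0..T} v * \<phi> v))"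
    using phi_nonneg z_nonneg
    by (intro AE_I2) (auto simp: indicator_def abs_mult mult.commute intro!: mult_left_mono monoD[OF z_mono])
qed measurable

lemma compensator_eq:
  assumes T: "0 \<le> T"
  shows "(LINT t:{0..T}|lborel. lam t) = \<mu> * T + a * (LINT v|lborel. indicator {0..T} v * (\<phi> v * z (T - v)))"
    (is "_ = _ + a * ?J")
proof -
  have J0: "0 \<le> ?J" using phi_nonneg z_nonneg by (intro Bochner_Integration.integral_nonneg) (auto simp: indicator_def)
  have "(\<integral>\<^sup>+v\<in>{0..T}. ennreal (a * \<phi> v * z (T - v)) \<partial>lborel)
      = (\<integral>\<^sup>+v. ennreal (a * (indicator {0..T} v * (\<phi> v * z (T - v)))) \<partial>lborel)"
    by (intro nn_integral_cong) (auto simp: indicator_def mult_ac)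
  also have "\<dots> = ennreal (LINT v|lborel. a * (indicator {0..T} v * (\<phi> v * z (T - v))))"
    using phi_nonneg z_nonneg a_nonneg
    by (intro nn_integral_eq_integral integrable_mult_right integrable_phi_z AE_I2) (auto simp: indicator_def)
  finally have J: "(\<integral>\<^sup>+v\<in>{0..T}. ennreal (a * \<phi> v * z (T - v)) \<partial>lborel) = ennreal (a * ?J)" by simp
  have "(LINT t:{0..T}|lborel. lam t) = enn2real (\<integral>\<^sup>+t. ennreal (indicator {0..T} t * lam t) \<partial>lborel)"
    unfolding set_lebesgue_integral_def using lam_pos
    by (subst integral_eq_nn_integral) (auto simp: indicator_def)
  also have "(\<integral>\<^sup>+t. ennreal (indicator {0..T} t * lam t) \<partial>lborel) = (\<integral>\<^sup>+t\<in>{0..T}. ennreal (lam t) \<partial>lborel)"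
    by (intro nn_integral_cong) (auto simp: indicator_def)
  also have "\<dots> = ennreal (\<mu> * T + a * ?J)"
    unfolding nn_integral_lam[OF T] J using T mu_pos a_nonneg J0 by (subst ennreal_plus) auto
  finally show ?thesis using T mu_pos a_nonneg J0 by (simp del: ennreal_plus)
qed

section \<open>Scaled paths, the renewal equation for them, and error estimates\<close>

definition scaled_z :: "nat \<Rightarrow> real \<Rightarrow> real" where
  "scaled_z n t = unit_ind t * (z (real n * t) / real n powr (2 * \<alpha>))"

definition scaled_m :: "nat \<Rightarrow> real \<Rightarrow> real" where
  "scaled_m n t = unit_ind t * ((z (real n * t) - (LINT s:{0..real n * t}|lborel. lam s)) / real n powr \<alpha>)"

lemma borel_measurable_scaled_z [measurable]: "scaled_z n \<in> borel_measurable borel"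
  unfolding scaled_z_def [abs_def] by measurable

lemma scaled_z_nonneg: "0 \<le> scaled_z n t"
  by (simp add: scaled_z_def z_nonneg)

text \<open>Monotonicity lets the terminal value bound the whole path. It is the source of the
  factor \<open>scaled_z n 1\<close> in all error terms.\<close>

lemma scaled_z_le: "\<bar>scaled_z n t\<bar> \<le> scaled_z n 1"
proof (cases "0 \<le> t \<and> t \<le> 1")
  case True
  have "z (real n * t) \<le> z (real n * 1)" by (intro monoD[OF z_mono] mult_left_mono) (use True in auto)
  then show ?thesis using True by (simp add: scaled_z_def z_nonneg divide_right_mono)
next
  case False
  then have "scaled_z n t = 0" by (auto simp: scaled_z_def indicator_def)
  then show ?thesis by (simp add: scaled_z_nonneg)
qed

text \<open>The compensator identity at time \<open>real n * t\<close>, divided by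
  \<open>n powr \<alpha>\<close>: the path is normalised by \<open>n powr (2 * \<alpha>)\<close>,
  which leaves a factor \<open>n powr \<alpha>\<close> in front, and the baseline contributes
  \<open>n / n powr \<alpha>\<close>.\<close>

lemma scaled_renewal:
  assumes n: "0 < n" and t: "0 \<le> t" "t \<le> 1"
  shows "scaled_m n t = real n powr \<alpha> * (scaled_z n t - a * conv (scaled_phi n) (scaled_z n) t)
    - \<mu> * real n powr (1 - \<alpha>) * t"
proof -
  let ?N = "real n powr (2 * \<alpha>)" and ?J = "LINT v|lborel. indicator {0..real n * t} v * (\<phi> v * z (real n * t - v))"
  have N: "0 < ?N" "?N = real n powr \<alpha> * real n powr \<alpha>" using n by (auto simp: powr_add[symmetric])
  have "?J = real n * (LINT v|lborel. indicator {0..real n * t} (real n * v) * (\<phi> (real n * v) * z (real n * t - real n * v)))"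
    using n lborel_integral_real_affine[of "real n" "\<lambda>v. indicator {0..real n * t} v * (\<phi> v * z (real n * t - v))" 0]
    by simp
  also have "\<dots> = (LINT v|lborel. ?N * (scaled_phi n v * scaled_z n (t - v)))"
    unfolding integral_mult_right_zero[symmetric]
    by (intro Bochner_Integration.integral_cong refl)
      (use n t in \<open>auto simp: scaled_phi_def scaled_z_def indicator_def zero_le_mult_iff mult_le_cancel_left_pos right_diff_distrib\<close>)
  finally have J: "?J = ?N * conv (scaled_phi n) (scaled_z n) t" by (simp add: conv_def)
  have "scaled_m n t = (z (real n * t) - (\<mu> * (real n * t) + a * ?J)) / real n powr \<alpha>"
    using t by (simp add: scaled_m_def compensator_eq)
  also have "\<dots> = (?N * scaled_z n t - \<mu> * (real n * t) - a * (?N * conv (scaled_phi n) (scaled_z n) t)) / real n powr \<alpha>"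
    using t n by (simp add: J scaled_z_def)
  also have "\<dots> = real n powr \<alpha> * (scaled_z n t - a * conv (scaled_phi n) (scaled_z n) t) - \<mu> * (real n / real n powr \<alpha>) * t"
    using n unfolding N(2) by (simp add: field_simps)
  also have "real n / real n powr \<alpha> = real n powr (1 - \<alpha>)" using n by (simp add: powr_diff)
  finally show ?thesis .
qed

abbreviation unit_id :: "real \<Rightarrow> real" where
  "unit_id s \<equiv> unit_ind s * s"

lemma abs_conv_scaled_z_le:
  "\<bar>conv (scaled_phi n) (scaled_z n) t\<bar> \<le> (LINT s|lborel. \<bar>scaled_phi n s\<bar>) * scaled_z n 1"
  by (intro abs_conv_le integrable_scaled_phi scaled_z_le)

lemma borel_measurable_scaled_phi [measurable]: "scaled_phi n \<in> borel_measurable borel"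
  using integrable_scaled_phi[of n] by (auto dest: borel_measurable_integrable)

text \<open>For negative \<open>t\<close> every term vanishes, so the identity may be convolved with
  kernels on the half-line; \<open>t \<le> 1\<close> remains because the cut-off breaks it
  afterwards.\<close>

lemma scaled_m_eq:
  assumes n: "0 < n" and t: "t \<le> 1"
  shows "scaled_m n t = real n powr \<alpha> * (scaled_z n t + (- a) * conv (scaled_phi n) (scaled_z n) t)
    + - (\<mu> * real n powr (1 - \<alpha>)) * unit_id t"
proof (cases "0 \<le> t")
  case True
  then show ?thesis using scaled_renewal[OF n True t] t by simp
next
  case False
  then have "(\<lambda>s. scaled_phi n s * scaled_z n (t - s)) = (\<lambda>_. 0)"
    by (auto simp: scaled_phi_def scaled_z_def indicator_def fun_eq_iff)
  then have "conv (scaled_phi n) (scaled_z n) t = 0" by (simp add: conv_def)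
  with False show ?thesis by (simp add: scaled_m_def scaled_z_def)
qed

text \<open>Both facts are read off the renewal equation, whose right-hand side is built from a
  bounded measurable path. They are what associativity of convolution asks of the factor
  \<open>scaled_m n\<close>.\<close>

lemma scaled_m_measurable: "0 < n \<Longrightarrow> scaled_m n \<in> borel_measurable borel"
  and scaled_m_bounded: "0 < n \<Longrightarrow> \<exists>B. \<forall>t. \<bar>scaled_m n t\<bar> \<le> B"
proof -
  assume n: "0 < n"
  let ?g = "\<lambda>t. real n powr \<alpha> * (scaled_z n t + (- a) * conv (scaled_phi n) (scaled_z n) t)
    + - (\<mu> * real n powr (1 - \<alpha>)) * unit_id t"
  have eq: "scaled_m n t = unit_ind t * ?g t" for t
  proof (cases "t \<in> {0..1}")
    case True then show ?thesis using scaled_m_eq[OF n, of t] by (simp del: of_nat_Suc)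
  qed (simp add: scaled_m_def)
  have "unit_ind \<in> borel_measurable borel" by simp
  then have "(\<lambda>t. unit_ind t * ?g t) \<in> borel_measurable borel" by measurable
  then show "scaled_m n \<in> borel_measurable borel" by (simp add: eq [abs_def])
  let ?B = "real n powr \<alpha> * (scaled_z n 1 + a * ((LINT s|lborel. \<bar>scaled_phi n s\<bar>) * scaled_z n 1)) + \<mu> * real n powr (1 - \<alpha>)"
  have "\<bar>scaled_m n t\<bar> \<le> ?B" for t
  proof -
    have 1: "\<bar>scaled_z n t + (- a) * conv (scaled_phi n) (scaled_z n) t\<bar>
        \<le> scaled_z n 1 + a * ((LINT s|lborel. \<bar>scaled_phi n s\<bar>) * scaled_z n 1)"
    proof (rule order_trans[OF abs_triangle_ineq add_mono[OF scaled_z_le]])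
      show "\<bar>(- a) * conv (scaled_phi n) (scaled_z n) t\<bar> \<le> a * ((LINT s|lborel. \<bar>scaled_phi n s\<bar>) * scaled_z n 1)"
        using mult_left_mono[OF abs_conv_scaled_z_le[of n t] a_nonneg] a_nonneg by (simp add: abs_mult)
    qed
    have 2: "\<bar>- (\<mu> * real n powr (1 - \<alpha>)) * unit_id t\<bar> \<le> \<mu> * real n powr (1 - \<alpha>)"
      using mu_pos by (auto simp: abs_mult indicator_def intro: mult_left_le)
    have "\<bar>?g t\<bar> \<le> ?B"
    proof (rule order_trans[OF abs_triangle_ineq add_mono[OF _ 2]])
      show "\<bar>real n powr \<alpha> * (scaled_z n t + (- a) * conv (scaled_phi n) (scaled_z n) t)\<bar>
          \<le> real n powr \<alpha> * (scaled_z n 1 + a * ((LINT s|lborel. \<bar>scaled_phi n s\<bar>) * scaled_z n 1))"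
        unfolding abs_mult[of "real n powr \<alpha>"] using mult_left_mono[OF 1, of "real n powr \<alpha>"] by simp
    qed
    moreover have "\<bar>unit_ind t * ?g t\<bar> \<le> \<bar>?g t\<bar>" by (simp add: indicator_def)
    ultimately show ?thesis unfolding eq by linarith
  qed
  then show "\<exists>B. \<forall>t. \<bar>scaled_m n t\<bar> \<le> B" by blast
qed

lemma abs_unit_id_le: "\<bar>unit_id s\<bar> \<le> 1"
  by (simp add: indicator_def)

text \<open>The second integration: convolving the renewal equation with the unit step and
  associating it with the density collects all multiples of the path into one kernel.\<close>

lemma conv_unit_scaled_m:
  assumes n: "0 < n" and t: "t \<le> 1"
  shows "conv unit_ind (scaled_m n) t
    = conv (renewal_kernel a n) (scaled_z n) t - \<mu> * real n powr (1 - \<alpha>) * conv unit_ind unit_id t"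
proof -
  let ?x = "scaled_z n" and ?p = "scaled_phi n" and ?A = "real n powr \<alpha>"
  note ii = integrable_unit_ind and zb = scaled_z_le[of n]
  have cb: "\<bar>conv ?p ?x s\<bar> \<le> (LINT s|lborel. \<bar>?p s\<bar>) * ?x 1" for s by (rule abs_conv_scaled_z_le)
  have ub: "\<bar>- (\<mu> * real n powr (1 - \<alpha>)) * unit_id s\<bar> \<le> \<bar>\<mu> * real n powr (1 - \<alpha>)\<bar> * 1" for s
    unfolding abs_mult abs_minus using abs_unit_id_le[of s] by (intro mult_left_mono) (auto simp: abs_mult)
  have ab: "\<bar>(- a) * conv ?p ?x s\<bar> \<le> \<bar>a\<bar> * ((LINT s|lborel. \<bar>?p s\<bar>) * ?x 1)" for s
    unfolding abs_mult abs_minus using cb by (intro mult_left_mono) auto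
  have sb: "\<bar>?x s + (- a) * conv ?p ?x s\<bar> \<le> ?x 1 + \<bar>a\<bar> * ((LINT s|lborel. \<bar>?p s\<bar>) * ?x 1)" for s
    by (rule order_trans[OF abs_triangle_ineq add_mono[OF zb ab]])
  have Ab: "\<bar>?A * (?x s + (- a) * conv ?p ?x s)\<bar> \<le> ?A * (?x 1 + \<bar>a\<bar> * ((LINT s|lborel. \<bar>?p s\<bar>) * ?x 1))" for s
    unfolding abs_mult using sb by (simp add: mult_left_mono)
  have "conv unit_ind (scaled_m n) t = conv unit_ind (\<lambda>s. ?A * (?x s + (- a) * conv ?p ?x s)
    + - (\<mu> * real n powr (1 - \<alpha>)) * unit_id s) t"
    unfolding conv_def[of unit_ind]
  proof (intro Bochner_Integration.integral_cong refl)
    fix s :: real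
    show "unit_ind s * scaled_m n (t - s) = unit_ind s * (?A * (?x (t - s) + - a * conv ?p ?x (t - s))
          + - (\<mu> * real n powr (1 - \<alpha>)) * unit_id (t - s))"
    proof (cases "s \<in> {0..1}")
      case True
      then show ?thesis using t by (subst scaled_m_eq[OF n]) auto
    qed simp
  qed
  also have "\<dots> = ?A * (conv unit_ind ?x t + (- a) * conv unit_ind (conv ?p ?x) t)
      + - (\<mu> * real n powr (1 - \<alpha>)) * conv unit_ind unit_id t"
    by (subst conv_add[OF ii _ Ab _ ub], (measurable)[2], subst conv_cmult, subst conv_add[OF ii _ zb _ ab], (measurable)[2], simp only: conv_cmult)
  also have "conv unit_ind (conv ?p ?x) t = conv (conv unit_ind ?p) ?x t"
    by (rule conv_assoc[OF ii integrable_scaled_phi _ zb, symmetric]) measurable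
  \<comment> \<open>Up to lag 1 the step convolved with the density is the distribution function;
    beyond lag 1 the two sides differ as kernels, but the path vanishes there.\<close>
  also have "?A * (conv unit_ind ?x t + (- a) * conv (conv unit_ind ?p) ?x t) = conv (renewal_kernel a n) ?x t"
  proof -
    have "conv (renewal_kernel a n) ?x t
        = (LINT s|lborel. ?A * (unit_ind s * ?x (t - s) + (- a) * (conv unit_ind ?p s * ?x (t - s))))"
      unfolding conv_def[of _ ?x]
    proof (intro Bochner_Integration.integral_cong refl)
      fix s :: real
      consider "s < 0" | "0 \<le> s" "s \<le> 1" | "1 < s" by linarith
      then show "renewal_kernel a n s * ?x (t - s)
          = ?A * (unit_ind s * ?x (t - s) + (- a) * (conv unit_ind ?p s * ?x (t - s)))"
      proof cases
        case 1
        then show ?thesis by (simp add: renewal_kernel_def conv_unit_scaled_phi_neg)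
      next
        case 2
        then show ?thesis by (simp add: renewal_kernel_def conv_unit_scaled_phi n algebra_simps)
      next
        case 3
        then have "?x (t - s) = 0" using t by (auto simp: scaled_z_def)
        then show ?thesis by simp
      qed
    qed
    also have "\<dots> = ?A * (conv unit_ind ?x t + (- a) * conv (conv unit_ind ?p) ?x t)"
      unfolding conv_def[of _ ?x]
      by (subst integral_mult_right_zero, subst Bochner_Integration.integral_add)
        (auto intro!: integrable_mult_right integrable_conv_integrand[where B = "?x 1"] zb
          integrable_conv ii integrable_scaled_phi simp: conv_def[symmetric])
    finally show ?thesis by simp
  qed
  finally show ?thesis by simp
qed

text \<open>The difference is computed exactly: the Mittag-Leffler kernel convolved with the kernel
  error acting on the path, plus the error of the baseline. The bound follows from L1 norms of
  kernels and the terminal value of the path. The constant \<nu> is arbitrary here and becomes the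
  limit of the scaled baseline.\<close>

lemma scaled_functional_estimate:
  assumes n: "0 < n" and t: "t \<le> 1" and lm: "0 < lm"
  shows "\<bar>\<delta> * (lm * conv unit_ind (scaled_z n) t) - conv (conv (ml_kernel \<alpha> lm) unit_ind) (scaled_m n) t
      - \<nu> * conv (conv (ml_kernel \<alpha> lm) unit_ind) unit_id t\<bar>
    \<le> (LINT s|lborel. \<bar>ml_kernel \<alpha> lm s\<bar>) * ((LINT w|lborel. \<bar>\<delta> * frac_kernel \<alpha> lm w - renewal_kernel a n w\<bar>) * scaled_z n 1)
      + \<bar>\<mu> * real n powr (1 - \<alpha>) - \<nu>\<bar> * \<bar>conv (conv (ml_kernel \<alpha> lm) unit_ind) unit_id t\<bar>"
proof -
  let ?f = "ml_kernel \<alpha> lm" and ?g = "frac_kernel \<alpha> lm" and ?G = "renewal_kernel a n"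
    and ?x = "scaled_z n" and ?c = "\<mu> * real n powr (1 - \<alpha>)"
  let ?d = "\<lambda>w. \<delta> * ?g w - ?G w"
  have f: "integrable lborel ?f" and g: "integrable lborel ?g" and G: "integrable lborel ?G"
    using alpha lm by (auto intro: integrable_ml_kernel integrable_frac_kernel integrable_renewal_kernel)
  have d: "integrable lborel ?d" by (intro Bochner_Integration.integrable_diff integrable_mult_right g G)
  have [measurable]: "?f \<in> borel_measurable borel" "?g \<in> borel_measurable borel" "?d \<in> borel_measurable borel"
    using f g d by (auto dest: borel_measurable_integrable)
  note zb = scaled_z_le[of n]
  obtain B where B: "\<And>s. \<bar>scaled_m n s\<bar> \<le> B" using scaled_m_bounded[OF n] by blast
  have idb: "\<bar>conv unit_ind unit_id s\<bar> \<le> (LINT s|lborel. \<bar>unit_ind s\<bar>) * 1" for s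
    by (intro abs_conv_le integrable_unit_ind abs_unit_id_le)
  have cidb: "\<bar>- ?c * conv unit_ind unit_id s\<bar> \<le> \<bar>?c\<bar> * ((LINT s|lborel. \<bar>unit_ind s\<bar>) * 1)" for s
    unfolding abs_mult[of "- ?c"] abs_minus using idb by (intro mult_left_mono) auto
  have Gb: "\<bar>conv ?G ?x s\<bar> \<le> (LINT s|lborel. \<bar>?G s\<bar>) * ?x 1" for s
    by (intro abs_conv_le G zb)
  have db: "\<bar>conv ?d ?x s\<bar> \<le> (LINT s|lborel. \<bar>?d s\<bar>) * ?x 1" for s
    by (intro abs_conv_le d zb)
  have uid: "conv (conv ?f unit_ind) unit_id t = conv ?f (conv unit_ind unit_id) t"
    by (rule conv_assoc[where w = unit_id and B = 1, OF f integrable_unit_ind _ abs_unit_id_le]) measurable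
  have "conv (conv ?f unit_ind) (scaled_m n) t = conv ?f (conv unit_ind (scaled_m n)) t"
    by (rule conv_assoc[OF f integrable_unit_ind scaled_m_measurable[OF n] B])
  also have "\<dots> = conv ?f (\<lambda>\<tau>. conv ?G ?x \<tau> + - ?c * conv unit_ind unit_id \<tau>) t"
    unfolding conv_def[of ?f]
  proof (intro Bochner_Integration.integral_cong refl)
    fix s :: real
    show "?f s * conv unit_ind (scaled_m n) (t - s)
        = ?f s * (conv ?G ?x (t - s) + - ?c * conv unit_ind unit_id (t - s))"
    proof (cases "0 < s")
      case True
      then show ?thesis using t by (simp add: conv_unit_scaled_m[OF n])
    qed (simp add: ml_kernel_def)
  qed
  also have "\<dots> = conv ?f (conv ?G ?x) t + conv ?f (\<lambda>\<tau>. - ?c * conv unit_ind unit_id \<tau>) t"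
    by (rule conv_add[OF f _ Gb _ cidb]) measurable
  also have "\<dots> = conv ?f (conv ?G ?x) t - ?c * conv ?f (conv unit_ind unit_id) t"
    by (subst conv_cmult) simp
  finally have y: "conv (conv ?f unit_ind) (scaled_m n) t = conv ?f (conv ?G ?x) t - ?c * conv (conv ?f unit_ind) unit_id t"
    by (simp only: uid)
  \<comment> \<open>The integral of the path is written through the limit kernel \<open>?g\<close>,
    so that it can be compared with \<open>?G\<close> under the same outer convolution.\<close>
  have "lm * conv unit_ind ?x t = conv ?f (conv ?g ?x) t"
    by (rule ml_kernel_conv_frac_kernel_conv[OF alpha lm t _ zb, symmetric])
      (auto simp: scaled_z_def)
  then have "\<delta> * (lm * conv unit_ind ?x t) = conv ?f (\<lambda>\<tau>. \<delta> * conv ?g ?x \<tau>) t"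
    by (simp only: conv_cmult)
  also have "(\<lambda>\<tau>. \<delta> * conv ?g ?x \<tau>) = (\<lambda>\<tau>. conv ?d ?x \<tau> + conv ?G ?x \<tau>)"
  proof
    fix \<tau>
    have "conv ?d ?x \<tau> = (LINT s|lborel. \<delta> * (?g s * ?x (\<tau> - s)) - ?G s * ?x (\<tau> - s))"
      unfolding conv_def[of _ ?x] by (simp add: algebra_simps)
    also have "\<dots> = (LINT s|lborel. \<delta> * (?g s * ?x (\<tau> - s))) - (LINT s|lborel. ?G s * ?x (\<tau> - s))"
      by (intro Bochner_Integration.integral_diff integrable_mult_right integrable_conv_integrand[OF g _ zb]
          integrable_conv_integrand[OF G _ zb]) measurable
    also have "\<dots> = \<delta> * conv ?g ?x \<tau> - conv ?G ?x \<tau>" by (simp add: conv_def)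
    finally show "\<delta> * conv ?g ?x \<tau> = conv ?d ?x \<tau> + conv ?G ?x \<tau>" by simp
  qed
  also have "conv ?f \<dots> t = conv ?f (conv ?d ?x) t + conv ?f (conv ?G ?x) t"
    by (rule conv_add[OF f _ db _ Gb]) measurable
  finally have eq: "\<delta> * (lm * conv unit_ind (scaled_z n) t) - conv (conv ?f unit_ind) (scaled_m n) t
      - \<nu> * conv (conv ?f unit_ind) unit_id t
      = conv ?f (conv ?d ?x) t + (?c - \<nu>) * conv (conv ?f unit_ind) unit_id t"
    unfolding y by (simp add: algebra_simps)
  have "\<bar>conv ?f (conv ?d ?x) t\<bar> \<le> (LINT s|lborel. \<bar>?f s\<bar>) * ((LINT s|lborel. \<bar>?d s\<bar>) * ?x 1)"
    by (intro abs_conv_le f db)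
  then show ?thesis
    unfolding eq by (intro order_trans[OF abs_triangle_ineq add_mono]) (simp_all add: abs_mult)
qed

text \<open>Averages over \<open>[1 - \<eta>, 1]\<close> stand in for the value at
  \<open>1 - \<eta>\<close>: evaluation at an interior time is not Skorokhod continuous, integration
  is.\<close>

lemma scaled_z_average_le:
  assumes \<eta>: "0 < \<eta>" "\<eta> \<le> 1"
  shows "(LINT s|lborel. indicator {1 - \<eta>..1} s / \<eta> * scaled_z n s) \<le> scaled_z n 1"
    and "scaled_z n (1 - \<eta>) \<le> (LINT s|lborel. indicator {1 - \<eta>..1} s / \<eta> * scaled_z n s)"
proof -
  have i: "integrable lborel (\<lambda>s. indicator {1 - \<eta>..1} s / \<eta> :: real)"
    using \<eta> by (intro integrable_divide) (simp add: integrable_indicator_iff)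
  have one: "(LINT s|lborel. indicator {1 - \<eta>..1} s / \<eta> * c) = c" for c :: real using \<eta> by simp
  have ix: "integrable lborel (\<lambda>s. indicator {1 - \<eta>..1} s / \<eta> * scaled_z n s)"
    by (rule integrable_mult_bounded[OF i _ scaled_z_le]) measurable
  have ic: "integrable lborel (\<lambda>s. indicator {1 - \<eta>..1} s / \<eta> * c)" for c :: real
    using i by (rule integrable_mult_left)
  have "(LINT s|lborel. indicator {1 - \<eta>..1} s / \<eta> * scaled_z n s) \<le> (LINT s|lborel. indicator {1 - \<eta>..1} s / \<eta> * scaled_z n 1)"
    by (intro integral_mono ix ic mult_left_mono) (use scaled_z_le[of n] \<eta> in \<open>auto intro: order_trans[OF abs_ge_self]\<close>)
  then show "(LINT s|lborel. indicator {1 - \<eta>..1} s / \<eta> * scaled_z n s) \<le> scaled_z n 1" by (simp only: one)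
  have "(LINT s|lborel. indicator {1 - \<eta>..1} s / \<eta> * scaled_z n (1 - \<eta>)) \<le> (LINT s|lborel. indicator {1 - \<eta>..1} s / \<eta> * scaled_z n s)"
  proof (intro integral_mono ix ic)
    fix s
    show "indicator {1 - \<eta>..1} s / \<eta> * scaled_z n (1 - \<eta>) \<le> indicator {1 - \<eta>..1} s / \<eta> * scaled_z n s"
    proof (cases "s \<in> {1 - \<eta>..1}")
      case True
      have "z (real n * (1 - \<eta>)) \<le> z (real n * s)"
        using True by (intro monoD[OF z_mono] mult_left_mono) auto
      then have "scaled_z n (1 - \<eta>) \<le> scaled_z n s"
        using True \<eta> by (auto simp: scaled_z_def intro!: divide_right_mono)
      then show ?thesis using True \<eta> by (intro mult_left_mono) auto
    qed simp
  qed
  then show "scaled_z n (1 - \<eta>) \<le> (LINT s|lborel. indicator {1 - \<eta>..1} s / \<eta> * scaled_z n s)"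
    by (simp only: one)
qed

text \<open>In the convolution at time 1, lags up to \<eta> see a path value of at most
  \<open>scaled_z n 1\<close>, longer lags one of at most \<open>scaled_z n (1 - \<eta>)\<close>,
  hence at most the average. Moving the first contribution to the left produces the factor
  \<open>renewal_kernel a n \<eta>\<close>.\<close>

lemma scaled_jump_estimate:
  assumes n: "0 < n" and \<eta>: "0 < \<eta>" "\<eta> \<le> 1"
  shows "scaled_z n 1 * renewal_kernel a n \<eta> \<le> scaled_m n 1 + \<mu> * real n powr (1 - \<alpha>)
    + a * (real n powr \<alpha> * (1 - cdf_phi (real n * \<eta>))) * (LINT s|lborel. indicator {1 - \<eta>..1} s / \<eta> * scaled_z n s)"
proof -
  let ?x = "scaled_z n" and ?p = "scaled_phi n" and ?A = "real n powr \<alpha>" and ?F = "cdf_phi (real n * \<eta>)"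
  define V where "V = (LINT s|lborel. indicator {1 - \<eta>..1} s / \<eta> * ?x s)"
  have V: "?x (1 - \<eta>) \<le> V" unfolding V_def by (rule scaled_z_average_le[OF \<eta>])
  have V0: "0 \<le> V" using V scaled_z_nonneg[of n "1 - \<eta>"] by linarith
  have pF: "(LINT v|lborel. ?p v * unit_ind (w - v)) = cdf_phi (real n * w)" if "0 \<le> w" "w \<le> 1" for w
    using conv_unit_scaled_phi[OF n that] by (simp only: conv_commute[of unit_ind]) (simp add: conv_def)
  have ip: "integrable lborel (\<lambda>v. ?p v * unit_ind (w - v))" for w
    by (rule integrable_conv_integrand[OF integrable_scaled_phi, where B = 1]) (auto simp: indicator_def)
  have "conv ?p ?x 1 \<le> (LINT v|lborel. (?p v * unit_ind (\<eta> - v)) * ?x 1 + (?p v * unit_ind (1 - v) - ?p v * unit_ind (\<eta> - v)) * V)"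
    unfolding conv_def
  proof (intro integral_mono integrable_conv_integrand[OF integrable_scaled_phi _ scaled_z_le])
    fix v
    consider "v < 0 \<or> 1 < v" | "0 \<le> v" "v \<le> \<eta>" | "\<eta> < v" "v \<le> 1" by linarith
    then show "?p v * ?x (1 - v) \<le> (?p v * unit_ind (\<eta> - v)) * ?x 1 + (?p v * unit_ind (1 - v) - ?p v * unit_ind (\<eta> - v)) * V"
    proof cases
      case 1
      then show ?thesis by (auto simp: scaled_phi_def)
    next
      case 2
      then show ?thesis using \<eta> order_trans[OF abs_ge_self scaled_z_le[of n "1 - v"]] scaled_phi_nonneg[of n v]
        by (simp add: mult_left_mono)
    next
      case 3
      have "z (real n * (1 - v)) \<le> z (real n * (1 - \<eta>))"
        using 3 by (intro monoD[OF z_mono] mult_left_mono) auto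
      then have "?x (1 - v) \<le> ?x (1 - \<eta>)"
        using 3 \<eta> by (auto simp: scaled_z_def intro!: divide_right_mono)
      then have "?x (1 - v) \<le> V" using V by linarith
      then show ?thesis using 3 \<eta> scaled_phi_nonneg[of n v] by (simp add: mult_left_mono)
    qed
  qed (auto intro!: Bochner_Integration.integrable_add Bochner_Integration.integrable_diff integrable_mult_left ip)
  also have "\<dots> = ?F * ?x 1 + (cdf_phi (real n * 1) - ?F) * V"
    using \<eta> by (subst Bochner_Integration.integral_add)
      (auto intro!: Bochner_Integration.integrable_diff integrable_mult_left ip simp: pF ip)
  \<comment> \<open>The mass of lags beyond 1 is added to the weight of \<open>V\<close>, which is
    nonnegative.\<close>
  also have "\<dots> \<le> ?F * ?x 1 + (1 - ?F) * V"
    using V0 cdf_phi_le_1[of "real n * 1"] by (intro add_left_mono mult_right_mono) auto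
  finally have "a * ?A * conv ?p ?x 1 \<le> a * ?A * (?F * ?x 1 + (1 - ?F) * V)"
    using a_nonneg by (intro mult_left_mono) auto
  moreover have "scaled_m n 1 = ?A * (?x 1 - a * conv ?p ?x 1) - \<mu> * real n powr (1 - \<alpha>)"
    using scaled_renewal[OF n, of 1] by simp
  ultimately show ?thesis
    using \<eta> unfolding V_def[symmetric] by (simp add: renewal_kernel_def algebra_simps)
qed

end

section \<open>Skorokhod-continuous functionals\<close>

text \<open>One radius serves both sides; \<open>l\<close> is the left limit. At the end points of
  the unit interval the outward condition is vacuous.\<close>

lemma cadlag01_local:
  assumes x: "cadlag01 x" and u: "0 \<le> u" "u \<le> 1" and e: "0 < e"
  shows "\<exists>d l. 0 < d \<and> (\<forall>s\<in>{0..1}. u < s \<longrightarrow> s < u + d \<longrightarrow> \<bar>x s - x u\<bar> < e) \<and>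
    (\<forall>s\<in>{0..1}. u - d < s \<longrightarrow> s < u \<longrightarrow> \<bar>x s - l\<bar> < e)"
proof -
  have "\<exists>d>0. \<forall>s\<in>{0..1}. u < s \<longrightarrow> s < u + d \<longrightarrow> \<bar>x s - x u\<bar> < e"
  proof (cases "u < 1")
    case True
    then have "(x \<longlongrightarrow> x u) (at_right u)" using x u by (auto simp: cadlag01_def continuous_within)
    then have "eventually (\<lambda>s. dist (x s) (x u) < e) (at_right u)" using e by (rule tendstoD)
    then obtain b where "b > u" "\<And>s. u < s \<Longrightarrow> s < b \<Longrightarrow> dist (x s) (x u) < e"
      by (auto simp: eventually_at_right_field)
    then show ?thesis by (intro exI[of _ "b - u"]) (auto simp: dist_real_def)
  qed (use u in \<open>auto intro!: exI[of _ 1]\<close>)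
  then obtain d1 where d1: "d1 > 0" "\<And>s. s \<in> {0..1} \<Longrightarrow> u < s \<Longrightarrow> s < u + d1 \<Longrightarrow> \<bar>x s - x u\<bar> < e" by blast
  have "\<exists>l. \<exists>d>0. \<forall>s\<in>{0..1}. u - d < s \<longrightarrow> s < u \<longrightarrow> \<bar>x s - l\<bar> < e"
  proof (cases "0 < u")
    case True
    then have "\<exists>l. (x \<longlongrightarrow> l) (at_left u)" using x u by (simp add: cadlag01_def)
    then obtain l where "(x \<longlongrightarrow> l) (at_left u)" ..
    then have "eventually (\<lambda>s. dist (x s) l < e) (at_left u)" using e by (rule tendstoD)
    then obtain b where "b < u" "\<And>s. b < s \<Longrightarrow> s < u \<Longrightarrow> dist (x s) l < e"
      by (auto simp: eventually_at_left_field)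
    then show ?thesis by (intro exI[of _ l] exI[of _ "u - b"]) (auto simp: dist_real_def)
  qed (use u in \<open>auto intro!: exI[of _ 1]\<close>)
  then obtain l d2 where d2: "d2 > 0" "\<And>s. s \<in> {0..1} \<Longrightarrow> u - d2 < s \<Longrightarrow> s < u \<Longrightarrow> \<bar>x s - l\<bar> < e" by blast
  show ?thesis by (intro exI[of _ "min d1 d2"] exI[of _ l]) (use d1 d2 in auto)
qed

text \<open>A bisection argument: boundedness passes to the union of adjacent intervals and holds on
  short intervals. Only points of the unit interval are bounded, since a short interval at 0 or 1
  may stick out.\<close>

lemma cadlag01_bounded:
  assumes x: "cadlag01 x"
  shows "\<exists>B. \<forall>t\<in>{0..1}. \<bar>x t\<bar> \<le> B"
proof -
  define P where "P a b \<longleftrightarrow> (\<exists>B. \<forall>t\<in>{a..b}. t \<in> {0..1} \<longrightarrow> \<bar>x t\<bar> \<le> B)" for a b :: real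
  have "P 0 1"
  proof (rule Bolzano)
    fix a b c :: real
    assume "P a b" "P b c"
    then obtain B1 B2 where B: "\<forall>t\<in>{a..b}. t \<in> {0..1} \<longrightarrow> \<bar>x t\<bar> \<le> B1" "\<forall>t\<in>{b..c}. t \<in> {0..1} \<longrightarrow> \<bar>x t\<bar> \<le> B2"
      unfolding P_def by blast
    show "P a c" unfolding P_def
    proof (intro exI[of _ "max B1 B2"] ballI impI)
      fix t assume "t \<in> {a..c}" "t \<in> {0..1}"
      then have "\<bar>x t\<bar> \<le> B1 \<or> \<bar>x t\<bar> \<le> B2" using B by (metis atLeastAtMost_iff linear)
      then show "\<bar>x t\<bar> \<le> max B1 B2" by auto
    qed
  next
    fix u :: real assume u: "0 \<le> u" "u \<le> 1"
    obtain d l where d: "0 < d" "\<And>s. s \<in> {0..1} \<Longrightarrow> u < s \<Longrightarrow> s < u + d \<Longrightarrow> \<bar>x s - x u\<bar> < 1"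
      "\<And>s. s \<in> {0..1} \<Longrightarrow> u - d < s \<Longrightarrow> s < u \<Longrightarrow> \<bar>x s - l\<bar> < 1"
      using cadlag01_local[OF x u zero_less_one] by blast
    have "P a b" if ab: "a \<le> u \<and> u \<le> b \<and> b - a < d" for a b
      unfolding P_def
    proof (intro exI[of _ "\<bar>x u\<bar> + \<bar>l\<bar> + 1"] ballI impI)
      fix t assume t: "t \<in> {a..b}" "t \<in> {0..1}"
      consider "t = u" | "u < t" "t < u + d" | "u - d < t" "t < u" using ab t by fastforce
      then show "\<bar>x t\<bar> \<le> \<bar>x u\<bar> + \<bar>l\<bar> + 1"
      proof cases
        case 2
        with d(2)[OF t(2)] show ?thesis by linarith
      next
        case 3
        with d(3)[OF t(2)] show ?thesis by linarith
      qed auto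
    qed
    then show "\<exists>d>0. \<forall>a b. a \<le> u \<and> u \<le> b \<and> b - a < d \<longrightarrow> P a b"
      using d(1) by blast
  qed simp
  then show ?thesis by (auto simp: P_def)
qed

text \<open>The points of oscillation at least \<open>e\<close> cannot accumulate in the unit
  interval, because close to any \<open>u\<close> the path stays near one value on each side. They
  are finitely many, and \<open>e = 1 / real (Suc n)\<close> exhausts the discontinuities.\<close>

lemma cadlag01_countable_discontinuities:
  assumes x: "cadlag01 x"
  shows "\<exists>D. countable D \<and> (\<forall>t\<in>{0<..<1} - D. isCont x t)"
proof -
  define J where "J e = {t \<in> {0<..<1}. \<not> (\<exists>d>0. \<forall>s. \<bar>s - t\<bar> < d \<longrightarrow> \<bar>x s - x t\<bar> < e)}" for e
  have fin: "finite (J e)" if e: "0 < e" for e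
  proof -
    have "\<not> u islimpt J e" if u: "u \<in> {0..1}" for u
    proof
      assume lim: "u islimpt J e"
      have "0 \<le> u" "u \<le> 1" using u by auto
      from cadlag01_local[OF x this half_gt_zero[OF e]]
      obtain d l where d: "0 < d" "\<And>s. s \<in> {0..1} \<Longrightarrow> u < s \<Longrightarrow> s < u + d \<Longrightarrow> \<bar>x s - x u\<bar> < e / 2"
        "\<And>s. s \<in> {0..1} \<Longrightarrow> u - d < s \<Longrightarrow> s < u \<Longrightarrow> \<bar>x s - l\<bar> < e / 2"
        by blast
      from lim d(1) obtain t where t: "t \<in> J e" "t \<noteq> u" "dist t u < d"
        unfolding islimpt_approachable by blast
      have t01: "0 < t" "t < 1" using t by (auto simp: J_def)
      \<comment> \<open>The radius \<open>r\<close> keeps a neighbourhood of \<open>t\<close> inside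
        the unit interval, on one side of \<open>u\<close> and within distance \<open>d\<close>;
        there the path is near the single constant \<open>c\<close>.\<close>
      define c where "c = (if u < t then x u else l)"
      define r where "r = Min {\<bar>t - u\<bar>, d - \<bar>t - u\<bar>, t, 1 - t}"
      have r: "0 < r" using t t01 by (simp add: r_def dist_real_def)
      have near: "\<bar>x s - c\<bar> < e / 2" if s: "\<bar>s - t\<bar> < r" for s
      proof -
        have *: "\<bar>s - t\<bar> < \<bar>t - u\<bar>" "\<bar>s - t\<bar> < d - \<bar>t - u\<bar>" "\<bar>s - t\<bar> < t" "\<bar>s - t\<bar> < 1 - t"
          using s by (auto simp: r_def)
        then have s01: "s \<in> {0..1}" by auto
        show ?thesis
        proof (cases "u < t")
          case True
          with * have "u < s" "s < u + d" by linarith+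
          with d(2)[OF s01] True show ?thesis by (simp add: c_def)
        next
          case False
          with * t(2) have "u - d < s" "s < u" by linarith+
          with d(3)[OF s01] False show ?thesis by (simp add: c_def)
        qed
      qed
      have "\<bar>x s - x t\<bar> < e" if "\<bar>s - t\<bar> < r" for s
      proof -
        have "\<bar>x t - c\<bar> < e / 2" using near[of t] r by simp
        then show ?thesis using near[OF that] by linarith
      qed
      with t(1) r show False by (auto simp: J_def)
    qed
    then have "finite ({0..1} \<inter> J e)" by (intro finite_not_islimpt_in_compact) auto
    moreover have "{0..1} \<inter> J e = J e" by (auto simp: J_def)
    ultimately show ?thesis by simp
  qed
  define D where "D = (\<Union>n. J (1 / real (Suc n)))"
  show ?thesis
  proof (intro exI[of _ D] conjI ballI)
    show "countable D" unfolding D_def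
      by (rule countable_UN) (simp_all add: countable_finite fin del: of_nat_Suc)
    fix t assume t: "t \<in> {0<..<1} - D"
    show "isCont x t" unfolding continuous_at_eps_delta
    proof (intro allI impI)
      fix e :: real assume "0 < e"
      then obtain n where n: "1 / real (Suc n) < e" using nat_approx_posE by blast
      from t have "t \<notin> J (1 / real (Suc n))" "t \<in> {0<..<1}" by (auto simp: D_def)
      then obtain d where d: "d > 0" "\<forall>s. \<bar>s - t\<bar> < d \<longrightarrow> \<bar>x s - x t\<bar> < 1 / real (Suc n)"
        unfolding J_def by auto
      then show "\<exists>d>0. \<forall>x'. dist x' t < d \<longrightarrow> dist (x x') (x t) < e"
        using n by (intro exI[of _ d]) (force simp: dist_real_def)
    qed
  qed
qed

lemma isCont_unit_ind_mult:
  assumes "s \<noteq> 0" "s \<noteq> 1" "s \<in> {0<..<1} \<Longrightarrow> isCont x s"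
  shows "isCont (\<lambda>s. unit_ind s * x s) s"
proof -
  consider "s < 0" | "0 < s" "s < 1" | "1 < s" using assms by linarith
  then show ?thesis
  proof cases
    case 1
    then have "eventually (\<lambda>r. r < 0) (nhds s)" using eventually_nhds_in_open[of "{..<0}" s] by simp
    then have "eventually (\<lambda>r. unit_ind r * x r = (\<lambda>_. 0) r) (nhds s)" by eventually_elim auto
    then show ?thesis by (simp only: isCont_cong) simp
  next
    case 2
    then have "eventually (\<lambda>r. r \<in> {0<..<1}) (nhds s)" by (intro eventually_nhds_in_open) auto
    then have "eventually (\<lambda>r. unit_ind r * x r = x r) (nhds s)" by eventually_elim auto
    then show ?thesis using 2 assms(3) by (subst isCont_cong) auto
  next
    case 3
    then have "eventually (\<lambda>r. 1 < r) (nhds s)" using eventually_nhds_in_open[of "{1<..}" s] by simp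
    then have "eventually (\<lambda>r. unit_ind r * x r = (\<lambda>_. 0) r) (nhds s)" by eventually_elim auto
    then show ?thesis by (simp only: isCont_cong) simp
  qed
qed

lemma cadlag01_unit_ind:
  assumes x: "cadlag01 x"
  shows "\<exists>D. countable D \<and> (\<forall>s. s \<notin> D \<longrightarrow> isCont (\<lambda>s. unit_ind s * x s) s)"
proof -
  obtain D where D: "countable D" "\<And>t. t \<in> {0<..<1} \<Longrightarrow> t \<notin> D \<Longrightarrow> isCont x t"
    using cadlag01_countable_discontinuities[OF x] by blast
  show ?thesis
    by (intro exI[of _ "D \<union> {0, 1}"]) (use D in \<open>auto intro!: isCont_unit_ind_mult\<close>)
qed

text \<open>Continuity off a countable set suffices. The cut-off is essential, as the cadlag
  property says nothing about the path outside the unit interval.\<close>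

lemma cadlag01_measurable:
  assumes x: "cadlag01 x"
  shows "(\<lambda>s. unit_ind s * x s) \<in> borel_measurable borel"
proof -
  obtain D where D: "countable D" "\<And>s. s \<notin> D \<Longrightarrow> isCont (\<lambda>s. unit_ind s * x s) s"
    using cadlag01_unit_ind[OF x] by blast
  show ?thesis
    by (rule borel_measurable_continuous_countable_exceptions[OF D(1)])
      (use D(2) in \<open>auto intro!: continuous_at_imp_continuous_on\<close>)
qed

text \<open>An infimum of reals is informative only for a nonempty set; boundedness of both paths
  and the identity time change supply an element.\<close>

lemma skor_dist_lessD:
  assumes x: "cadlag01 x" and y: "cadlag01 y" and d: "skor_dist x y < d"
  shows "\<exists>l\<in>time_changes01. \<forall>t\<in>{0..1}. \<bar>l t - t\<bar> \<le> d \<and> \<bar>x t - y (l t)\<bar> \<le> d"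
proof -
  let ?S = "{e. \<exists>l\<in>time_changes01. \<forall>t\<in>{0..1}. \<bar>l t - t\<bar> \<le> e \<and> \<bar>x t - y (l t)\<bar> \<le> e}"
  obtain B C where B: "\<And>t. t \<in> {0..1} \<Longrightarrow> \<bar>x t\<bar> \<le> B" and C: "\<And>t. t \<in> {0..1} \<Longrightarrow> \<bar>y t\<bar> \<le> C"
    using cadlag01_bounded[OF x] cadlag01_bounded[OF y] by blast
  have "(\<lambda>t. t) \<in> time_changes01" by (auto simp: time_changes01_def strict_mono_on_def)
  moreover have "\<bar>t - t\<bar> \<le> B + C \<and> \<bar>x t - y t\<bar> \<le> B + C" if "t \<in> {0..1}" for t
    using B[OF that] C[OF that] by auto
  ultimately have "B + C \<in> ?S" by (intro CollectI bexI[of _ "\<lambda>t. t"] ballI)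
  then have "?S \<noteq> {}" by blast
  from cInf_lessD[OF this] d obtain e l where "e < d" "l \<in> time_changes01"
    "\<forall>t\<in>{0..1}. \<bar>l t - t\<bar> \<le> e \<and> \<bar>x t - y (l t)\<bar> \<le> e"
    unfolding skor_dist_def by blast
  then show ?thesis by (intro bexI[of _ l]) (auto intro: order_trans[OF _ less_imp_le])
qed

lemma time_changes01_range:
  assumes l: "l \<in> time_changes01" and t: "t \<in> {0..1}"
  shows "l t \<in> {0..1}"
proof -
  have m: "mono_on {0..1} l" using l by (auto simp: time_changes01_def intro: strict_mono_on_imp_mono_on)
  have "l 0 \<le> l t" "l t \<le> l 1" using t by (auto intro!: mono_onD[OF m])
  then show ?thesis using l by (simp add: time_changes01_def)
qed

text \<open>Time changes fix 1, so evaluation there is continuous; the terminal value may enter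
  functionals although interior evaluations may not.\<close>

lemma skor_convergent_at_1:
  assumes x: "cadlag01 x" and xs: "\<And>m. cadlag01 (xs m)" and d: "\<And>m. skor_dist (xs m) x < 1 / real (Suc m)"
  shows "(\<lambda>m. xs m 1) \<longlonglongrightarrow> x 1"
proof (rule LIM_zero_cancel, rule Lim_null_comparison)
  show "eventually (\<lambda>m. norm (xs m 1 - x 1) \<le> 1 / real (Suc m)) sequentially"
  proof (rule always_eventually, rule allI)
    fix m
    obtain l where "l \<in> time_changes01" "\<And>t. t \<in> {0..1} \<Longrightarrow> \<bar>l t - t\<bar> \<le> 1 / real (Suc m) \<and> \<bar>xs m t - x (l t)\<bar> \<le> 1 / real (Suc m)"
      using skor_dist_lessD[OF xs x d] by blast
    from this(1) this(2)[of 1] show "norm (xs m 1 - x 1) \<le> 1 / real (Suc m)"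
      by (simp add: time_changes01_def)
  qed
  show "(\<lambda>m. 1 / real (Suc m)) \<longlonglongrightarrow> 0" by real_asymp
qed

text \<open>Skorokhod convergence implies convergence at each interior continuity point of the
  limit, hence almost everywhere, with the uniform bound \<open>B + 1\<close>.\<close>

lemma skor_convergent_integral:
  assumes k: "integrable lborel k"
    and x: "cadlag01 x" and xs: "\<And>m. cadlag01 (xs m)" and d: "\<And>m. skor_dist (xs m) x < 1 / real (Suc m)"
  shows "(\<lambda>m. LINT s|lborel. k s * (unit_ind s * xs m s)) \<longlonglongrightarrow> (LINT s|lborel. k s * (unit_ind s * x s))"
proof -
  obtain B where B: "\<And>t. t \<in> {0..1} \<Longrightarrow> \<bar>x t\<bar> \<le> B" using cadlag01_bounded[OF x] by blast
  obtain D where D: "countable D" "\<And>t. t \<in> {0<..<1} \<Longrightarrow> t \<notin> D \<Longrightarrow> isCont x t"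
    using cadlag01_countable_discontinuities[OF x] by blast
  have "\<forall>m. \<exists>l. l \<in> time_changes01 \<and> (\<forall>t\<in>{0..1}. \<bar>l t - t\<bar> \<le> 1 / real (Suc m) \<and> \<bar>xs m t - x (l t)\<bar> \<le> 1 / real (Suc m))"
    using skor_dist_lessD[OF xs x d] by blast
  then obtain l where l: "\<And>m. l m \<in> time_changes01"
    "\<And>m t. t \<in> {0..1} \<Longrightarrow> \<bar>l m t - t\<bar> \<le> 1 / real (Suc m)"
    "\<And>m t. t \<in> {0..1} \<Longrightarrow> \<bar>xs m t - x (l m t)\<bar> \<le> 1 / real (Suc m)" by metis
  have [measurable]: "k \<in> borel_measurable borel" using k by (auto dest: borel_measurable_integrable)
  have [measurable]: "(\<lambda>s. unit_ind s * xs m s) \<in> borel_measurable borel" for m by (rule cadlag01_measurable[OF xs])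
  have [measurable]: "(\<lambda>s. unit_ind s * x s) \<in> borel_measurable borel" by (rule cadlag01_measurable[OF x])
  have z: "(\<lambda>m. 1 / real (Suc m)) \<longlonglongrightarrow> 0" by real_asymp
  show ?thesis
  proof (rule integral_dominated_convergence[where w = "\<lambda>s. \<bar>k s\<bar> * (B + 1)"])
    show "integrable lborel (\<lambda>s. \<bar>k s\<bar> * (B + 1))" using k by simp
    have "D \<union> {0, 1} \<in> null_sets lborel" using D(1) by (intro countable_imp_null_set_lborel) auto
    then have "AE s in lborel. s \<notin> D \<union> {0, 1}" by (rule AE_not_in)
    then show "AE s in lborel. (\<lambda>m. k s * (unit_ind s * xs m s)) \<longlonglongrightarrow> k s * (unit_ind s * x s)"
    proof eventually_elim
      case (elim s)
      show ?case
      proof (cases "s \<in> {0<..<1}")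
        case True
        then have s: "s \<in> {0..1}" by auto
        have "(\<lambda>m. l m s) \<longlonglongrightarrow> s"
          by (rule LIM_zero_cancel, rule Lim_null_comparison[OF _ z]) (use l(2)[OF s] in auto)
        moreover have "isCont x s" using elim True D(2) by simp
        ultimately have "(\<lambda>m. x (l m s)) \<longlonglongrightarrow> x s" by (rule isCont_tendsto_compose[rotated])
        moreover have "(\<lambda>m. xs m s - x (l m s)) \<longlonglongrightarrow> 0"
          by (rule Lim_null_comparison[OF _ z]) (use l(3)[OF s] in auto)
        ultimately have "(\<lambda>m. (xs m s - x (l m s)) + x (l m s)) \<longlonglongrightarrow> 0 + x s" by (intro tendsto_add)
        then show ?thesis by (intro tendsto_intros) simp
      next
        case False
        then have "s \<notin> {0..1}" using elim by auto
        then show ?thesis by simp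
      qed
    qed
    show "AE s in lborel. norm (k s * (unit_ind s * xs m s)) \<le> \<bar>k s\<bar> * (B + 1)" for m
    proof (rule AE_I2)
      fix s :: real
      have "\<bar>unit_ind s * xs m s\<bar> \<le> B + 1"
      proof (cases "s \<in> {0..1}")
        case True
        have "1 / real (Suc m) \<le> 1" by simp
        then have "\<bar>xs m s\<bar> \<le> B + 1"
          using l(3)[OF True, of m] B[OF time_changes01_range[OF l(1)[of m] True]] by linarith
        then show ?thesis using True by simp
      next
        case False
        have "0 \<le> B" using B[of 0] by simp
        with False show ?thesis by simp
      qed
      then show "norm (k s * (unit_ind s * xs m s)) \<le> \<bar>k s\<bar> * (B + 1)"
        unfolding real_norm_def abs_mult[of "k s"] by (rule mult_left_mono) simp
    qed
  qed measurable
qed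

text \<open>A common shape for the integrated limit identity, whose value is wanted at a fixed time,
  and for the two inequalities at the end point; the passage to the limit in law is then carried out
  once.\<close>

definition path_functional ::
  "(real \<Rightarrow> real) \<Rightarrow> (real \<Rightarrow> real) \<Rightarrow> real \<Rightarrow> real \<Rightarrow> real \<Rightarrow> (real \<Rightarrow> real) \<Rightarrow> (real \<Rightarrow> real) \<Rightarrow> real" where
  "path_functional k h b c d x y =
     (LINT s|lborel. k s * (unit_ind s * x s)) + (LINT s|lborel. h s * (unit_ind s * y s)) + b * x 1 + c * y 1 + d"

text \<open>Counterexamples at distance \<open>1 / real (Suc m)\<close> form sequences, which
  reduces continuity to a statement accessible to dominated convergence.\<close>

lemma skor_continuous2_I:
  assumes "\<And>x y xs ys. cadlag01 x \<Longrightarrow> cadlag01 y \<Longrightarrow> (\<And>m. cadlag01 (xs m)) \<Longrightarrow> (\<And>m. cadlag01 (ys m)) \<Longrightarrow>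
    (\<And>m. skor_dist (xs m) x < 1 / real (Suc m)) \<Longrightarrow> (\<And>m. skor_dist (ys m) y < 1 / real (Suc m)) \<Longrightarrow>
    (\<lambda>m. G (xs m) (ys m)) \<longlonglongrightarrow> G x y"
  shows "skor_continuous2 G"
  unfolding skor_continuous2_def
proof (intro allI impI, rule ccontr)
  fix x y and \<epsilon> :: real
  assume xy: "cadlag01 x" "cadlag01 y" and \<epsilon>: "0 < \<epsilon>"
    and no: "\<not> (\<exists>\<delta>>0. \<forall>x' y'. cadlag01 x' \<longrightarrow> cadlag01 y' \<longrightarrow> skor_dist x' x < \<delta> \<longrightarrow> skor_dist y' y < \<delta> \<longrightarrow> \<bar>G x' y' - G x y\<bar> < \<epsilon>)"
  have "\<forall>m. \<exists>x' y'. cadlag01 x' \<and> cadlag01 y' \<and> skor_dist x' x < 1 / real (Suc m) \<and> skor_dist y' y < 1 / real (Suc m) \<and> \<not> \<bar>G x' y' - G x y\<bar> < \<epsilon>"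
  proof
    fix m
    have "0 < 1 / real (Suc m)" by simp
    with no show "\<exists>x' y'. cadlag01 x' \<and> cadlag01 y' \<and> skor_dist x' x < 1 / real (Suc m) \<and> skor_dist y' y < 1 / real (Suc m) \<and> \<not> \<bar>G x' y' - G x y\<bar> < \<epsilon>"
      by blast
  qed
  then obtain xs ys where s: "\<And>m. cadlag01 (xs m)" "\<And>m. cadlag01 (ys m)"
    "\<And>m. skor_dist (xs m) x < 1 / real (Suc m)" "\<And>m. skor_dist (ys m) y < 1 / real (Suc m)"
    "\<And>m. \<not> \<bar>G (xs m) (ys m) - G x y\<bar> < \<epsilon>" by metis
  from assms[OF xy s(1-4)] \<epsilon> have "eventually (\<lambda>m. dist (G (xs m) (ys m)) (G x y) < \<epsilon>) sequentially"
    by (rule tendstoD)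
  then show False using s(5) by (simp add: dist_real_def)
qed

text \<open>The errors in the pathwise identities are of the form \<open>\<epsilon> * (1 + \<bar>x 1\<bar>)\<close> because the scaled paths
  are nonnegative and monotone; dividing by \<open>1 + \<bar>x 1\<bar>\<close> makes a separate tightness argument superfluous.\<close>

definition truncated_functional :: "((real \<Rightarrow> real) \<Rightarrow> (real \<Rightarrow> real) \<Rightarrow> real) \<Rightarrow> (real \<Rightarrow> real) \<Rightarrow> (real \<Rightarrow> real) \<Rightarrow> real" where
  "truncated_functional Q x y = min 1 (max 0 (Q x y) / (1 + \<bar>x 1\<bar>))"

lemma skor_continuous2_truncated_path_functional:
  assumes k: "integrable lborel k" and h: "integrable lborel h"
  shows "skor_continuous2 (truncated_functional (path_functional k h b c d))"
proof (rule skor_continuous2_I)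
  fix x y xs ys
  assume *: "cadlag01 x" "cadlag01 y" "\<And>m::nat. cadlag01 (xs m)" "\<And>m::nat. cadlag01 (ys m)"
    "\<And>m. skor_dist (xs m) x < 1 / real (Suc m)" "\<And>m. skor_dist (ys m) y < 1 / real (Suc m)"
  show "(\<lambda>m. truncated_functional (path_functional k h b c d) (xs m) (ys m))
      \<longlonglongrightarrow> truncated_functional (path_functional k h b c d) x y"
    unfolding truncated_functional_def path_functional_def
    by (intro tendsto_intros tendsto_min tendsto_max skor_convergent_integral[OF k *(1,3,5)]
        skor_convergent_integral[OF h *(2,4,6)] skor_convergent_at_1[OF *(1,3,5)] skor_convergent_at_1[OF *(2,4,6)])
      auto
qed

lemma truncated_functional_bounds: "0 \<le> truncated_functional Q x y" "truncated_functional Q x y \<le> 1"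
  by (auto simp: truncated_functional_def)

text \<open>Measurability at each fixed time becomes joint measurability in \<omega> and
  \<open>s\<close> by right continuity, approximating \<open>s\<close> by grid points; integrating
  out \<open>s\<close> then preserves measurability.\<close>

lemma measurable_cadlag_integral:
  assumes X: "\<And>\<omega>. \<omega> \<in> space N \<Longrightarrow> cadlag01 (X \<omega>)" and Xm: "\<And>t. (\<lambda>\<omega>. X \<omega> t) \<in> borel_measurable N"
    and k [measurable]: "k \<in> borel_measurable borel"
  shows "(\<lambda>\<omega>. LINT s|lborel. k s * (unit_ind s * X \<omega> s)) \<in> borel_measurable N"
proof -
  \<comment> \<open>With \<open>i\<close> the floor of \<open>real (Suc m) * s\<close> this is a
    grid point strictly to the right of \<open>s\<close>, capped at 1; at \<open>s = 1\<close> the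
    cap gives the exact value.\<close>
  let ?g = "\<lambda>m (i::int). min 1 ((real_of_int i + 1) / real (Suc m))"
  have [measurable]: "(\<lambda>p. X (fst p) (?g m i)) \<in> borel_measurable (N \<Otimes>\<^sub>M borel)" for m i
    using measurable_compose[OF measurable_fst Xm] .
  have [measurable]: "(\<lambda>p. X (fst p) (?g m \<lfloor>real (Suc m) * snd p\<rfloor>)) \<in> borel_measurable (N \<Otimes>\<^sub>M borel)" for m
    by (rule measurable_compose_countable[where f = "\<lambda>i p. X (fst p) (?g m i)"]) measurable
  have "(\<lambda>p. unit_ind (snd p) * X (fst p) (snd p)) \<in> borel_measurable (N \<Otimes>\<^sub>M borel)"
  proof (rule borel_measurable_LIMSEQ_real)
    show "(\<lambda>p. unit_ind (snd p) * X (fst p) (?g m \<lfloor>real (Suc m) * snd p\<rfloor>)) \<in> borel_measurable (N \<Otimes>\<^sub>M borel)" for m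
      by measurable
    fix p :: "'a \<times> real" assume "p \<in> space (N \<Otimes>\<^sub>M borel)"
    then obtain \<omega> s where p: "p = (\<omega>, s)" "\<omega> \<in> space N" by (auto simp: space_pair_measure)
    let ?r = "\<lambda>m. ?g m \<lfloor>real (Suc m) * s\<rfloor>"
    consider "s \<notin> {0..1}" | "s = 1" | "0 \<le> s" "s < 1" by fastforce
    then have "(\<lambda>m. unit_ind s * X \<omega> (?r m)) \<longlonglongrightarrow> unit_ind s * X \<omega> s"
    proof cases
      case 2
      have "?r m = 1" for m using 2 by (simp add: min_def field_simps)
      with 2 show ?thesis by simp
    next
      case 3
      have gt: "s < (real_of_int \<lfloor>real (Suc m) * s\<rfloor> + 1) / real (Suc m)" for m
        using floor_correct[of "real (Suc m) * s"] by (simp add: field_simps)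
      have le: "(real_of_int \<lfloor>real (Suc m) * s\<rfloor> + 1) / real (Suc m) \<le> s + 1 / real (Suc m)" for m
      proof -
        have "(real_of_int \<lfloor>real (Suc m) * s\<rfloor> + 1) / real (Suc m) \<le> (real (Suc m) * s + 1) / real (Suc m)"
          by (intro divide_right_mono add_right_mono of_int_floor_le) simp
        also have "\<dots> = s + 1 / real (Suc m)" by (simp add: add_divide_distrib)
        finally show ?thesis .
      qed
      have "?r \<longlonglongrightarrow> s"
      proof (rule tendsto_sandwich)
        show "eventually (\<lambda>m. s \<le> ?r m) sequentially" using gt 3 by (intro always_eventually allI) (auto intro: less_imp_le)
        show "eventually (\<lambda>m. ?r m \<le> s + 1 / real (Suc m)) sequentially" using le by (intro always_eventually allI) (auto intro: min.coboundedI2)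
        show "(\<lambda>m. s + 1 / real (Suc m)) \<longlonglongrightarrow> s" by real_asymp
      qed simp
      moreover have "?r m \<in> {s<..}" for m using gt 3 by auto
      ultimately have "filterlim ?r (at_right s) sequentially"
        unfolding filterlim_at by (auto simp: less_imp_neq[THEN not_sym])
      moreover have "(X \<omega> \<longlongrightarrow> X \<omega> s) (at_right s)"
        using X[OF p(2)] 3 by (auto simp: cadlag01_def continuous_within)
      ultimately have "(\<lambda>m. X \<omega> (?r m)) \<longlonglongrightarrow> X \<omega> s" by (rule filterlim_compose[rotated])
      then show ?thesis by (rule tendsto_mult_left)
    qed simp
    then show "(\<lambda>m. unit_ind (snd p) * X (fst p) (?g m \<lfloor>real (Suc m) * snd p\<rfloor>)) \<longlonglongrightarrow> unit_ind (snd p) * X (fst p) (snd p)"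
      by (simp add: p)
  qed
  then have [measurable]: "(\<lambda>(\<omega>, s). unit_ind s * X \<omega> s) \<in> borel_measurable (N \<Otimes>\<^sub>M lborel)"
    by (simp add: case_prod_beta' cong: measurable_cong_sets)
  have "(\<lambda>(\<omega>, s). k s * (unit_ind s * X \<omega> s)) \<in> borel_measurable (N \<Otimes>\<^sub>M lborel)"
    by measurable
  then show ?thesis by (rule lborel.borel_measurable_lebesgue_integral)
qed

section \<open>Identification of the limit\<close>

text \<open>The truncated functional takes values in \<open>[0, 1]\<close> and its prelimit means
  are at most \<open>max 0 (\<epsilon> j)\<close>. Its mean at the limit is therefore 0, so it
  vanishes almost surely, which says that the functional itself is not positive. Equalities follow
  by applying this with both signs.\<close>

lemma law_limit_functional_nonpos:
  fixes M :: "'a measure" and N :: "'b measure"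
  assumes M: "prob_space M" and N: "prob_space N"
    and k: "integrable lborel k" and h: "integrable lborel h"
    and cad: "\<forall>\<omega>\<in>space N. cadlag01 (X \<omega>) \<and> cadlag01 (Y \<omega>)"
    and meas: "\<forall>t. (\<lambda>\<omega>. X \<omega> t) \<in> borel_measurable N \<and> (\<lambda>\<omega>. Y \<omega> t) \<in> borel_measurable N"
    and law: "\<forall>G. skor_continuous2 G \<longrightarrow> (\<exists>B. \<forall>x y. \<bar>G x y\<bar> \<le> B) \<longrightarrow>
        (\<lambda>j. \<integral>\<omega>. G (XX j \<omega>) (YY j \<omega>) \<partial>M) \<longlonglongrightarrow> (\<integral>\<omega>. G (X \<omega>) (Y \<omega>) \<partial>N)"
    and bound: "eventually (\<lambda>j. AE \<omega> in M.
        path_functional k h b c d (XX j \<omega>) (YY j \<omega>) \<le> \<epsilon> j * (1 + \<bar>XX j \<omega> 1\<bar>)) sequentially"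
    and \<epsilon>: "\<epsilon> \<longlonglongrightarrow> 0"
  shows "AE \<omega> in N. path_functional k h b c d (X \<omega>) (Y \<omega>) \<le> 0"
proof -
  interpret M: prob_space M by (rule M)
  interpret N: prob_space N by (rule N)
  let ?Q = "path_functional k h b c d"
  let ?G = "truncated_functional ?Q"
  have lim: "(\<lambda>j. \<integral>\<omega>. ?G (XX j \<omega>) (YY j \<omega>) \<partial>M) \<longlonglongrightarrow> (\<integral>\<omega>. ?G (X \<omega>) (Y \<omega>) \<partial>N)"
  proof (rule law[rule_format])
    show "skor_continuous2 ?G" by (rule skor_continuous2_truncated_path_functional[OF k h])
    show "\<exists>B. \<forall>x y. \<bar>?G x y\<bar> \<le> B"
      using truncated_functional_bounds by (intro exI[of _ 1]) (simp add: abs_of_nonneg)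
  qed
  have le: "eventually (\<lambda>j. (\<integral>\<omega>. ?G (XX j \<omega>) (YY j \<omega>) \<partial>M) \<le> max 0 (\<epsilon> j)) sequentially"
    using bound
  proof eventually_elim
    case (elim j)
    show ?case
    \<comment> \<open>Measurability under \<open>M\<close> is not known, but a non-integrable function has Bochner integral 0.\<close>
    proof (cases "integrable M (\<lambda>\<omega>. ?G (XX j \<omega>) (YY j \<omega>))")
      case True
      have "(\<integral>\<omega>. ?G (XX j \<omega>) (YY j \<omega>) \<partial>M) \<le> (\<integral>\<omega>. max 0 (\<epsilon> j) \<partial>M)"
      proof (rule integral_mono_AE[OF True])
        show "AE \<omega> in M. ?G (XX j \<omega>) (YY j \<omega>) \<le> max 0 (\<epsilon> j)"
          using elim
        proof eventually_elim
          case (elim \<omega>)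
          have "\<epsilon> j * (1 + \<bar>XX j \<omega> 1\<bar>) \<le> max 0 (\<epsilon> j) * (1 + \<bar>XX j \<omega> 1\<bar>)"
            by (intro mult_right_mono) auto
          with elim have "?Q (XX j \<omega>) (YY j \<omega>) \<le> max 0 (\<epsilon> j) * (1 + \<bar>XX j \<omega> 1\<bar>)" by linarith
          then have "max 0 (?Q (XX j \<omega>) (YY j \<omega>)) / (1 + \<bar>XX j \<omega> 1\<bar>) \<le> max 0 (\<epsilon> j)"
            by (simp add: pos_divide_le_eq add_pos_nonneg)
          then show ?case unfolding truncated_functional_def by (rule min.coboundedI2)
        qed
      qed simp
      then show ?thesis by (simp add: M.prob_space)
    qed (simp add: not_integrable_integral_eq)
  qed
  have z: "(\<lambda>j. max 0 (\<epsilon> j)) \<longlonglongrightarrow> max 0 0" by (intro tendsto_max tendsto_const \<epsilon>)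
  have EG: "(\<integral>\<omega>. ?G (X \<omega>) (Y \<omega>) \<partial>N) \<le> 0"
    using tendsto_le[OF sequentially_bot z lim le] by simp
  have [measurable]: "(\<lambda>\<omega>. X \<omega> t) \<in> borel_measurable N" "(\<lambda>\<omega>. Y \<omega> t) \<in> borel_measurable N" for t
    using meas by auto
  have [measurable]: "(\<lambda>\<omega>. LINT s|lborel. k s * (unit_ind s * X \<omega> s)) \<in> borel_measurable N"
    "(\<lambda>\<omega>. LINT s|lborel. h s * (unit_ind s * Y \<omega> s)) \<in> borel_measurable N"
    using cad meas k h by (auto intro!: measurable_cadlag_integral dest: borel_measurable_integrable)
  have Gm: "(\<lambda>\<omega>. ?G (X \<omega>) (Y \<omega>)) \<in> borel_measurable N"
    unfolding truncated_functional_def path_functional_def by measurable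
  have Gi: "integrable N (\<lambda>\<omega>. ?G (X \<omega>) (Y \<omega>))"
    by (rule N.integrable_const_bound[where B = 1, OF _ Gm])
      (simp add: truncated_functional_bounds abs_of_nonneg)
  have "(\<integral>\<omega>. ?G (X \<omega>) (Y \<omega>) \<partial>N) = 0"
    using EG by (intro antisym Bochner_Integration.integral_nonneg) (simp_all add: truncated_functional_bounds)
  then have "AE \<omega> in N. ?G (X \<omega>) (Y \<omega>) = 0"
    using integral_nonneg_eq_0_iff_AE[OF Gi] by (simp add: truncated_functional_bounds)
  then show ?thesis
  proof eventually_elim
    case (elim \<omega>)
    have "max 0 (?Q (X \<omega>) (Y \<omega>)) / (1 + \<bar>X \<omega> 1\<bar>) \<le> 0"
      using elim unfolding truncated_functional_def by (auto simp: min_def split: if_splits)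
    then show ?case by (simp add: divide_le_0_iff add_pos_nonneg not_le) (smt (verit))
  qed
qed

lemma LINT_reflected_kernel: "(LINT s|lborel. u (t - s) * w s) = conv u w t"
  by (subst conv_commute) (simp add: conv_def mult.commute)

text \<open>To the right of \<open>t\<close>, the mean of \<rho> over a short interval with rational
  end points is 0 and at the same time close to \<open>\<rho> t\<close>. Rational times suffice, as
  almost sure identities are available for countably many times.\<close>

lemma right_continuous_eq_0:
  assumes [measurable]: "\<rho> \<in> borel_measurable borel" and b: "\<And>s. \<bar>\<rho> s\<bar> \<le> B" and neg: "\<And>s. s < 0 \<Longrightarrow> \<rho> s = 0"
    and t: "0 \<le> t" "t < 1" and rc: "(\<rho> \<longlongrightarrow> \<rho> t) (at_right t)"
    and zero: "\<And>q. q \<in> \<rat> \<Longrightarrow> 0 \<le> q \<Longrightarrow> q \<le> 1 \<Longrightarrow> conv unit_ind \<rho> q = 0"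
  shows "\<rho> t = 0"
proof -
  have "\<bar>\<rho> t\<bar> \<le> 0 + e" if e: "0 < e" for e
  proof -
    have "eventually (\<lambda>s. dist (\<rho> s) (\<rho> t) < e) (at_right t)" using rc e by (rule tendstoD)
    then obtain c where c: "t < c" "\<And>s. t < s \<Longrightarrow> s < c \<Longrightarrow> \<bar>\<rho> s - \<rho> t\<bar> < e"
      by (auto simp: eventually_at_right_field dist_real_def)
    obtain p where p: "p \<in> \<rat>" "t < p" "p < min c 1" using Rats_dense_in_real[of t "min c 1"] c t by auto
    obtain q where q: "q \<in> \<rat>" "p < q" "q < min c 1" using Rats_dense_in_real[of p "min c 1"] p by auto
    have i: "integrable lborel (\<lambda>s. \<rho> s * unit_ind (r - s))" for r
    proof -
      have "integrable lborel (\<lambda>s. unit_ind (r - s) * \<rho> s)"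
        by (rule integrable_mult_bounded[OF integrable_reflect[OF integrable_unit_ind] _ b]) measurable
      then show ?thesis by (simp add: mult.commute)
    qed
    have ipq: "integrable lborel (\<lambda>s. indicator {p<..q} s :: real)"
      using q by (simp add: integrable_indicator_iff)
    have "0 = conv unit_ind \<rho> q - conv unit_ind \<rho> p" using zero p q t by simp
    also have "\<dots> = (LINT s|lborel. \<rho> s * unit_ind (q - s)) - (LINT s|lborel. \<rho> s * unit_ind (p - s))"
      by (simp add: conv_commute[of unit_ind] conv_def[of \<rho>])
    also have "\<dots> = (LINT s|lborel. \<rho> s * unit_ind (q - s) - \<rho> s * unit_ind (p - s))"
      by (rule Bochner_Integration.integral_diff[OF i i, symmetric])
    \<comment> \<open>Since \<open>p\<close> and \<open>q\<close> are below 1, the unit windows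
      ending there start below 0, where \<rho> vanishes; only the piece between \<open>p\<close> and
      \<open>q\<close> survives.\<close>
    also have "\<dots> = (LINT s|lborel. indicator {p<..q} s * \<rho> s)"
    proof (intro Bochner_Integration.integral_cong refl)
      fix s
      show "\<rho> s * unit_ind (q - s) - \<rho> s * unit_ind (p - s) = indicator {p<..q} s * \<rho> s"
        using neg[of s] p q t by (auto simp: indicator_def)
    qed
    finally have z: "(LINT s|lborel. indicator {p<..q} s * \<rho> s) = 0" by simp
    have r: "integrable lborel (\<lambda>s. indicator {p<..q} s * \<rho> s)"
      by (rule integrable_mult_bounded[OF ipq _ b]) measurable
    have "\<rho> t * (q - p) = (LINT s|lborel. indicator {p<..q} s * \<rho> t) - (LINT s|lborel. indicator {p<..q} s * \<rho> s)"
      using q z by simp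
    also have "\<dots> = (LINT s|lborel. indicator {p<..q} s * \<rho> t - indicator {p<..q} s * \<rho> s)"
      by (rule Bochner_Integration.integral_diff[OF integrable_mult_left[OF ipq] r, symmetric])
    finally have "\<bar>\<rho> t * (q - p)\<bar> \<le> (LINT s|lborel. \<bar>indicator {p<..q} s * \<rho> t - indicator {p<..q} s * \<rho> s\<bar>)"
      by (simp only: integral_abs_bound)
    also have "\<dots> \<le> (LINT s|lborel. indicator {p<..q} s * e)"
    proof (rule integral_mono')
      show "integrable lborel (\<lambda>s. indicator {p<..q} s * e)" by (rule integrable_mult_left[OF ipq])
      fix s
      show "\<bar>indicator {p<..q} s * \<rho> t - indicator {p<..q} s * \<rho> s\<bar> \<le> indicator {p<..q} s * e"
        using c(2)[of s] p q by (auto simp: indicator_def abs_minus_commute)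
      show "0 \<le> indicator {p<..q} s * e" using e by simp
    qed
    also have "\<dots> = e * (q - p)" using q by simp
    finally have "\<bar>\<rho> t\<bar> * (q - p) \<le> e * (q - p)" using q by (simp add: abs_mult)
    then show ?thesis using q by simp
  qed
  then have "\<bar>\<rho> t\<bar> \<le> 0" by (rule field_le_epsilon)
  then show ?thesis by simp
qed

section \<open>Recovering the path from the integrated identities\<close>

context heavy_tail
begin

text \<open>For \<open>\<nu> = \<mu>s * \<delta>\<close> this is \<open>\<delta> * lm\<close> times
  the claimed right-hand side; as a convolution on the line it is continuous everywhere, also at
  1.\<close>

definition limit_path :: "real \<Rightarrow> real \<Rightarrow> (real \<Rightarrow> real) \<Rightarrow> real \<Rightarrow> real" where
  "limit_path lm \<nu> y = conv (ml_kernel \<alpha> lm) (\<lambda>s. unit_ind s * y s + \<nu> * (unit_ind s * s))"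

lemma limit_path_eq:
  assumes lm: "0 < lm" and y: "cadlag01 y" and t: "0 \<le> t" "t \<le> 1"
  shows "limit_path lm \<nu> y t = (LINT s:{0..t}|lborel. f_al \<alpha> lm (t - s) * y s) + \<nu> * (LINT s:{0..t}|lborel. f_al \<alpha> lm (t - s) * s)"
proof -
  have [measurable]: "(\<lambda>s. unit_ind s * y s) \<in> borel_measurable borel" by (rule cadlag01_measurable[OF y])
  have f: "integrable lborel (ml_kernel \<alpha> lm)" using alpha lm by (intro integrable_ml_kernel)
  have [measurable]: "ml_kernel \<alpha> lm \<in> borel_measurable borel" using f by (auto dest: borel_measurable_integrable)
  obtain B where B: "\<forall>t\<in>{0..1}. \<bar>y t\<bar> \<le> B" using cadlag01_bounded[OF y] by blast
  have B0: "0 \<le> B" using B[rule_format, of 0] by simp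
  have yb: "\<bar>unit_ind s * y s\<bar> \<le> B" for s using B B0 by (simp add: indicator_def)
  have sb: "\<bar>\<nu> * (unit_ind s * s)\<bar> \<le> \<bar>\<nu>\<bar>" for s by (auto simp: indicator_def abs_mult intro: mult_left_le)
  have eq: "conv (ml_kernel \<alpha> lm) (\<lambda>s. unit_ind s * v s) t = (LINT s:{0..t}|lborel. f_al \<alpha> lm (t - s) * v s)"
    if [measurable]: "(\<lambda>s. unit_ind s * v s) \<in> borel_measurable borel" for v
  proof -
    have "(LINT s:{0..t}|lborel. f_al \<alpha> lm (t - s) * v s)
        = (LINT s|lborel. indicator {0..t} s * f_al \<alpha> lm (t - s) * (unit_ind s * v s))"
      unfolding set_lebesgue_integral_def using t
      by (intro Bochner_Integration.integral_cong refl) (auto simp: indicator_def)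
    also have "\<dots> = (LINT s|lborel. ml_kernel \<alpha> lm (t - s) * (unit_ind s * v s))"
    proof (rule integral_cong_AE)
      show "AE s in lborel. indicator {0..t} s * f_al \<alpha> lm (t - s) * (unit_ind s * v s) = ml_kernel \<alpha> lm (t - s) * (unit_ind s * v s)"
        \<comment> \<open>The integrands differ at most at \<open>s = 0\<close> when
          \<open>t = 1\<close>: the lag is then 1, outside the open cut-off of
          \<open>ml_kernel\<close>.\<close>
        using AE_lborel_singleton[of 0]
      proof eventually_elim
        case (elim s)
        show ?case using elim t by (auto simp: indicator_def ml_kernel_def f_al_def)
      qed
    qed measurable
    also have "\<dots> = conv (ml_kernel \<alpha> lm) (\<lambda>s. unit_ind s * v s) t" by (rule LINT_reflected_kernel)
    finally show ?thesis by simp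
  qed
  have "limit_path lm \<nu> y t = conv (ml_kernel \<alpha> lm) (\<lambda>s. unit_ind s * y s) t + conv (ml_kernel \<alpha> lm) (\<lambda>s. \<nu> * (unit_ind s * s)) t"
    unfolding limit_path_def by (rule conv_add[OF f _ yb _ sb]) measurable
  also have "conv (ml_kernel \<alpha> lm) (\<lambda>s. \<nu> * (unit_ind s * s)) t = \<nu> * conv (ml_kernel \<alpha> lm) (\<lambda>s. unit_ind s * s) t"
    by (rule conv_cmult)
  finally show ?thesis by (simp add: eq)
qed

text \<open>Before time 1, the difference of the two sides is right continuous with vanishing
  integrals up to rational times. At time 1, the averages in \<open>upper\<close> and
  \<open>lower\<close> tend to the left limit, which the continuous right-hand side identifies, and
  the two inequalities squeeze \<open>x 1\<close> onto it.\<close>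

lemma limit_path_characterization:
  assumes lm: "0 < lm" and x: "cadlag01 x" and y: "cadlag01 y"
    and I: "\<And>q. q \<in> \<rat> \<Longrightarrow> 0 \<le> q \<Longrightarrow> q \<le> 1 \<Longrightarrow>
      \<delta> * (lm * conv unit_ind (\<lambda>s. unit_ind s * x s) q)
        = conv (conv (ml_kernel \<alpha> lm) unit_ind) (\<lambda>s. unit_ind s * y s) q
          + \<nu> * conv (conv (ml_kernel \<alpha> lm) unit_ind) (\<lambda>s. unit_ind s * s) q"
    and upper: "\<And>m. x 1 * (K / \<alpha> * (1 / real (Suc m)) powr (- \<alpha>) - lm * \<delta>) - y 1 - \<nu>
      \<le> K / \<alpha> * (1 / real (Suc m)) powr (- \<alpha>)
        * (LINT s|lborel. indicator {1 - 1 / real (Suc m)..1} s / (1 / real (Suc m)) * (unit_ind s * x s))"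
    and lower: "\<And>m. (LINT s|lborel. indicator {1 - 1 / real (Suc m)..1} s / (1 / real (Suc m)) * (unit_ind s * x s)) \<le> x 1"
    and t: "0 \<le> t" "t \<le> 1"
  shows "\<delta> * lm * x t = limit_path lm \<nu> y t"
proof -
  let ?f = "ml_kernel \<alpha> lm" and ?x = "\<lambda>s. unit_ind s * x s" and ?y = "\<lambda>s. unit_ind s * y s"
  let ?w = "\<lambda>s. ?y s + \<nu> * (unit_ind s * s)" and ?R = "limit_path lm \<nu> y"
  have f: "integrable lborel ?f" using alpha lm by (intro integrable_ml_kernel)
  have [measurable]: "?f \<in> borel_measurable borel" using f by (auto dest: borel_measurable_integrable)
  have xm [measurable]: "?x \<in> borel_measurable borel" and ym [measurable]: "?y \<in> borel_measurable borel"
    by (rule cadlag01_measurable[OF x], rule cadlag01_measurable[OF y])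
  have wm: "?w \<in> borel_measurable borel" by measurable
  obtain A where A: "\<forall>t\<in>{0..1}. \<bar>x t\<bar> \<le> A" using cadlag01_bounded[OF x] by blast
  obtain B where B: "\<forall>t\<in>{0..1}. \<bar>y t\<bar> \<le> B" using cadlag01_bounded[OF y] by blast
  have AB0: "0 \<le> A" "0 \<le> B" using A[rule_format, of 0] B[rule_format, of 0] by simp_all
  have xb: "\<bar>?x s\<bar> \<le> A" for s using A AB0 by (simp add: indicator_def)
  have yb: "\<bar>?y s\<bar> \<le> B" for s using B AB0 by (simp add: indicator_def)
  have sb: "\<bar>\<nu> * (unit_ind s * s)\<bar> \<le> \<bar>\<nu>\<bar>" for s by (auto simp: indicator_def abs_mult intro: mult_left_le)
  have wb: "\<bar>?w s\<bar> \<le> B + \<bar>\<nu>\<bar>" for s by (rule order_trans[OF abs_triangle_ineq add_mono[OF yb sb]])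
  obtain D where D: "countable D" "\<And>s. s \<notin> D \<Longrightarrow> isCont ?y s" using cadlag01_unit_ind[OF y] by blast
  have Rc: "isCont ?R s" for s
    unfolding limit_path_def
  proof (rule continuous_conv[OF f wm wb])
    show "countable (D \<union> {0, 1})" using D by simp
    fix s assume s: "s \<notin> D \<union> {0, 1}"
    have "isCont (\<lambda>s. unit_ind s * s) s" using s by (intro isCont_unit_ind_mult) auto
    from continuous_add[OF D(2) continuous_mult[OF continuous_const this]] s
    show "isCont ?w s" by simp
  qed
  have Rb: "\<bar>?R s\<bar> \<le> (LINT s|lborel. \<bar>?f s\<bar>) * (B + \<bar>\<nu>\<bar>)" for s
    unfolding limit_path_def by (rule abs_conv_le[OF f wb])
  have Rm [measurable]: "?R \<in> borel_measurable borel" unfolding limit_path_def by (intro borel_measurable_conv wm) measurable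
  have Rneg: "?R s = 0" if "s < 0" for s
  proof -
    have "(\<lambda>r. ?f r * ?w (s - r)) = (\<lambda>_. 0)"
      using that by (auto simp: ml_kernel_def indicator_def fun_eq_iff)
    then show ?thesis by (simp add: limit_path_def conv_def)
  qed
  define \<rho> where "\<rho> s = (\<delta> * lm) * ?x s + (- 1) * ?R s" for s
  have \<rho>m: "\<rho> \<in> borel_measurable borel" unfolding \<rho>_def by measurable
  have 1: "\<bar>(\<delta> * lm) * ?x s\<bar> \<le> \<bar>\<delta> * lm\<bar> * A" for s
    unfolding abs_mult[of "\<delta> * lm"] using xb by (intro mult_left_mono) auto
  have 2: "\<bar>(- 1) * ?R s\<bar> \<le> (LINT s|lborel. \<bar>?f s\<bar>) * (B + \<bar>\<nu>\<bar>)" for s using Rb[of s] by simp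
  have \<rho>b: "\<bar>\<rho> s\<bar> \<le> \<bar>\<delta> * lm\<bar> * A + (LINT s|lborel. \<bar>?f s\<bar>) * (B + \<bar>\<nu>\<bar>)" for s
    unfolding \<rho>_def by (rule order_trans[OF abs_triangle_ineq add_mono[OF 1 2]])
  have zero: "conv unit_ind \<rho> q = 0" if q: "q \<in> \<rat>" "0 \<le> q" "q \<le> 1" for q
  proof -
    have cfi: "integrable lborel (conv ?f unit_ind)" by (intro integrable_conv f integrable_unit_ind)
    have "conv unit_ind \<rho> q = conv unit_ind (\<lambda>s. (\<delta> * lm) * ?x s) q + conv unit_ind (\<lambda>s. (- 1) * ?R s) q"
      unfolding \<rho>_def by (rule conv_add[OF integrable_unit_ind _ 1 _ 2]) measurable
    also have "conv unit_ind (\<lambda>s. (\<delta> * lm) * ?x s) q = \<delta> * lm * conv unit_ind ?x q" by (rule conv_cmult)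
    also have "conv unit_ind (\<lambda>s. (- 1) * ?R s) q = - 1 * conv unit_ind ?R q" by (rule conv_cmult)
    also have "conv unit_ind ?R q = conv (conv unit_ind ?f) ?w q"
      unfolding limit_path_def by (rule conv_assoc[OF integrable_unit_ind f wm wb, symmetric])
    also have "conv unit_ind ?f = conv ?f unit_ind" by (rule ext) (rule conv_commute)
    also have "conv (conv ?f unit_ind) ?w q = conv (conv ?f unit_ind) ?y q + conv (conv ?f unit_ind) (\<lambda>s. \<nu> * (unit_ind s * s)) q"
      by (rule conv_add[OF cfi _ yb _ sb]) measurable
    also have "conv (conv ?f unit_ind) (\<lambda>s. \<nu> * (unit_ind s * s)) q = \<nu> * conv (conv ?f unit_ind) (\<lambda>s. unit_ind s * s) q"
      by (rule conv_cmult)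
    finally show ?thesis using I[OF q] by simp
  qed
  have main: "\<delta> * lm * x s = ?R s" if s: "0 \<le> s" "s < 1" for s
  proof -
    have "(x \<longlongrightarrow> x s) (at_right s)" using x s by (auto simp: cadlag01_def continuous_within)
    moreover have "eventually (\<lambda>r. x r = ?x r) (at_right s)"
      unfolding eventually_at_right_field using s by (intro exI[of _ 1]) auto
    ultimately have "(?x \<longlongrightarrow> ?x s) (at_right s)" using s by (simp add: tendsto_cong)
    moreover have "(?R \<longlongrightarrow> ?R s) (at_right s)"
      using Rc[of s] by (simp add: continuous_at filterlim_at_split)
    ultimately have "(\<rho> \<longlongrightarrow> \<rho> s) (at_right s)" unfolding \<rho>_def
      by (intro tendsto_add tendsto_mult[OF tendsto_const])
    from right_continuous_eq_0[OF \<rho>m \<rho>b _ s this zero] have "\<rho> s = 0"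
      using Rneg by (simp add: \<rho>_def)
    then show ?thesis using s by (simp add: \<rho>_def)
  qed
  show ?thesis
  proof (cases "t < 1")
    case True
    with main t show ?thesis by simp
  next
    case False
    then have t1: "t = 1" using t by simp
    have dl: "0 < \<delta> * lm" using delta_pos lm by simp
    \<comment> \<open>This is the left limit of \<open>x\<close> at 1, because \<open>x\<close>
      equals the continuous function \<open>?R\<close> over \<open>\<delta> * lm\<close> before
      1.\<close>
    define L where "L = ?R 1 / (\<delta> * lm)"
    define V where "V m = (LINT s|lborel. indicator {1 - 1 / real (Suc m)..1} s / (1 / real (Suc m)) * ?x s)" for m
    have V: "V \<longlonglongrightarrow> L"
    proof (rule LIMSEQ_I)
      fix e :: real assume e: "0 < e"
      have "((\<lambda>s. ?R s / (\<delta> * lm)) \<longlongrightarrow> L) (at_left 1)"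
        unfolding L_def using Rc[of 1] dl by (intro tendsto_intros) (auto simp: continuous_at filterlim_at_split)
      then have "eventually (\<lambda>s. dist (?R s / (\<delta> * lm)) L < e / 2) (at_left 1)"
        by (rule tendstoD) (use e in simp)
      then obtain c where c: "c < 1" "\<And>s. c < s \<Longrightarrow> s < 1 \<Longrightarrow> \<bar>?R s / (\<delta> * lm) - L\<bar> < e / 2"
        by (auto simp: eventually_at_left_field dist_real_def)
      have xL: "\<bar>x s - L\<bar> < e / 2" if "c < s" "0 \<le> s" "s < 1" for s
      proof -
        have "x s = ?R s / (\<delta> * lm)" using that dl by (subst main[symmetric]) auto
        then show ?thesis using c(2)[of s] that by simp
      qed
      obtain m0 where m0: "1 / real (Suc m0) < 1 - c" using c(1) nat_approx_posE[of "1 - c"] by auto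
      show "\<exists>no. \<forall>m\<ge>no. norm (V m - L) < e"
      proof (intro exI[of _ m0] allI impI)
        fix m assume "m0 \<le> m"
        then have "1 / real (Suc m) \<le> 1 / real (Suc m0)" by (simp add: frac_le)
        define \<eta> where "\<eta> = 1 / real (Suc m)"
        have \<eta>: "0 < \<eta>" "\<eta> \<le> 1" "c < 1 - \<eta>"
          using m0 \<open>1 / real (Suc m) \<le> 1 / real (Suc m0)\<close> by (auto simp: \<eta>_def)
        let ?u = "\<lambda>s. indicator {1 - \<eta>..1} s / \<eta> :: real"
        have i: "integrable lborel ?u"
          using \<eta> by (intro integrable_divide) (simp add: integrable_indicator_iff)
        have ix: "integrable lborel (\<lambda>s. ?u s * ?x s)" by (rule integrable_mult_bounded[OF i _ xb]) measurable
        have one: "(LINT s|lborel. ?u s * k) = k" for k using \<eta> by simp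
        have "V m - L = (LINT s|lborel. ?u s * ?x s) - (LINT s|lborel. ?u s * L)"
          unfolding V_def \<eta>_def[symmetric] one ..
        also have "\<dots> = (LINT s|lborel. ?u s * ?x s - ?u s * L)"
          by (rule Bochner_Integration.integral_diff[OF ix integrable_mult_left[OF i], symmetric])
        finally have "\<bar>V m - L\<bar> \<le> (LINT s|lborel. \<bar>?u s * ?x s - ?u s * L\<bar>)" by (simp only: integral_abs_bound)
        also have "\<dots> \<le> (LINT s|lborel. ?u s * (e / 2))"
        proof (rule integral_mono_AE)
          show "integrable lborel (\<lambda>s. \<bar>?u s * ?x s - ?u s * L\<bar>)"
            by (intro integrable_abs Bochner_Integration.integrable_diff ix integrable_mult_left i)
          show "integrable lborel (\<lambda>s. ?u s * (e / 2))" by (rule integrable_mult_left[OF i])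
          show "AE s in lborel. \<bar>?u s * ?x s - ?u s * L\<bar> \<le> ?u s * (e / 2)"
            using AE_lborel_singleton[of 1]
          proof eventually_elim
            case (elim s)
            show ?case
            proof (cases "s \<in> {1 - \<eta>..1}")
              case True
              then have "\<bar>x s - L\<bar> \<le> e / 2" using xL[of s] elim \<eta> by auto
              then have "\<bar>x s - L\<bar> / \<eta> \<le> (e / 2) / \<eta>" using \<eta> by (intro divide_right_mono) auto
              moreover have "?u s * ?x s - ?u s * L = (x s - L) / \<eta>" using True \<eta> by (simp add: diff_divide_distrib)
              ultimately show ?thesis using True \<eta> by simp
            qed simp
          qed
        qed
        also have "\<dots> = e / 2" by (rule one)
        finally show "norm (V m - L) < e" using e by simp
      qed
    qed
    \<comment> \<open>This factor tends to infinity, so dividing \<open>upper\<close> by it removes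
      the terms with \<open>lm * \<delta>\<close>, \<open>y 1\<close> and \<nu>, and leaves
      \<open>x 1 \<le> L\<close> in the limit.\<close>
    let ?P = "\<lambda>m. K / \<alpha> * (1 / real (Suc m)) powr (- \<alpha>)"
    have P: "filterlim ?P at_top sequentially" using alpha K_pos by real_asymp
    have "x 1 \<le> L"
    proof (rule LIMSEQ_le)
      show "(\<lambda>m. x 1 * (1 - lm * \<delta> / ?P m) - (y 1 + \<nu>) / ?P m) \<longlonglongrightarrow> x 1"
      proof -
        have "(\<lambda>m. x 1 * (1 - lm * \<delta> / ?P m) - (y 1 + \<nu>) / ?P m) \<longlonglongrightarrow> x 1 * (1 - 0) - 0"
          by (intro tendsto_intros real_tendsto_divide_at_top[OF tendsto_const P])
        then show ?thesis by simp
      qed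
      show "\<exists>N. \<forall>m\<ge>N. x 1 * (1 - lm * \<delta> / ?P m) - (y 1 + \<nu>) / ?P m \<le> V m"
      proof (intro exI[of _ 0] allI impI)
        fix m
        have P0: "0 < ?P m" using alpha K_pos by simp
        have "x 1 * (?P m - lm * \<delta>) - y 1 - \<nu> \<le> ?P m * V m"
          unfolding V_def by (rule upper)
        then have "(x 1 * (?P m - lm * \<delta>) - y 1 - \<nu>) / ?P m \<le> V m"
          by (simp only: pos_divide_le_eq[OF P0] mult.commute[of "?P m"])
        moreover have "(x 1 * (?P m - lm * \<delta>) - y 1 - \<nu>) / ?P m = x 1 * (1 - lm * \<delta> / ?P m) - (y 1 + \<nu>) / ?P m"
        proof -
          have "(u * (p - q) - v - w) / p = u * (1 - q / p) - (v + w) / p" if "0 < p" for u v w p q :: real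
            using that by (simp add: field_simps)
          from this[OF P0] show ?thesis .
        qed
        ultimately show "x 1 * (1 - lm * \<delta> / ?P m) - (y 1 + \<nu>) / ?P m \<le> V m" by simp
      qed
    qed (rule V)
    moreover have "L \<le> x 1" by (rule LIMSEQ_le_const2[OF V]) (use lower in \<open>auto simp: V_def\<close>)
    ultimately have "x 1 = L" by simp
    then show ?thesis using t1 delta_pos lm by (simp add: L_def)
  qed
qed

end

section \<open>Almost sure identities at the limit point\<close>

theorem theorem1p1:
  fixes \<phi> :: "real \<Rightarrow> real" and \<alpha> K lm \<mu>s :: real
    and a \<mu> :: "nat \<Rightarrow> real"
    and M :: "'a measure" and PP :: "'a \<Rightarrow> (real \<times> real) measure"
    and Z lam :: "nat \<Rightarrow> 'a \<Rightarrow> real \<Rightarrow> real"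
    and N :: "'b measure" and X Ms :: "'b \<Rightarrow> real \<Rightarrow> real"
    and r :: "nat \<Rightarrow> nat"
  assumes PRM: "poisson_random_measure M PP"
    and phi_meas: "\<phi> \<in> borel_measurable lborel"
    and phi_nonneg: "\<forall>t\<ge>0. \<phi> t \<ge> 0"
    and phi_int: "set_integrable lborel {0..} \<phi>"
    and phi_one: "(LINT t:{0..}|lborel. \<phi> t) = 1"
    and alpha: "1/2 < \<alpha>" "\<alpha> < 1"
    and K_pos: "K > 0"
    and tail: "((\<lambda>x. \<alpha> * x powr \<alpha> * (1 - (LINT t:{0..x}|lborel. \<phi> t))) \<longlongrightarrow> K) at_top"
    and lam_pos: "lm > 0" and mus_pos: "\<mu>s > 0"
    and a_gt: "\<forall>n\<ge>1. a n > 1" and mu_pos: "\<forall>n\<ge>1. \<mu> n > 0"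
    and a_lim: "a \<longlonglongrightarrow> 1"
    and a_rate: "(\<lambda>n. real n powr \<alpha> * (a n - 1)) \<longlonglongrightarrow> lm * (K * Gamma (1 - \<alpha>) / \<alpha>)"
    and mu_rate: "(\<lambda>n. real n powr (1 - \<alpha>) * \<mu> n) \<longlonglongrightarrow> \<mu>s * (K * Gamma (1 - \<alpha>) / \<alpha>)"
    and Z_meas: "\<forall>n\<ge>1. \<forall>t. (\<lambda>\<omega>. Z n \<omega> t) \<in> borel_measurable M \<and> (\<lambda>\<omega>. lam n \<omega> t) \<in> borel_measurable M"
    and Z_sol: "\<forall>n\<ge>1. AE \<omega> in M.
        (\<forall>t<0. Z n \<omega> t = 0) \<and> mono (Z n \<omega>) \<and> (\<forall>t. continuous (at_right t) (Z n \<omega>)) \<and>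
        lam n \<omega> \<in> borel_measurable lborel \<and>
        (\<forall>t\<ge>0. ennreal (Z n \<omega> t) =
           emeasure (PP \<omega>) {(s, z). 0 \<le> s \<and> s \<le> t \<and> 0 \<le> z \<and> z \<le> lam n \<omega> s}) \<and>
        (\<forall>t\<ge>0. ennreal (lam n \<omega> t) =
           ennreal (\<mu> n) + (\<integral>\<^sup>+ s\<in>{0..<t}. ennreal (a n * \<phi> (t - s)) \<partial>interval_measure (Z n \<omega>)))"
    and N_prob: "prob_space N"
    and lim_cadlag: "\<forall>\<omega>\<in>space N. cadlag01 (X \<omega>) \<and> cadlag01 (Ms \<omega>)"
    and lim_meas: "\<forall>t. (\<lambda>\<omega>. X \<omega> t) \<in> borel_measurable N \<and> (\<lambda>\<omega>. Ms \<omega> t) \<in> borel_measurable N"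
    and subseq: "strict_mono r"
    and conv_law: "\<forall>G. skor_continuous2 G \<longrightarrow> (\<exists>B. \<forall>x y. \<bar>G x y\<bar> \<le> B) \<longrightarrow>
        (\<lambda>k. \<integral>\<omega>. G (\<lambda>t. Z (r k) \<omega> (real (r k) * t) / real (r k) powr (2 * \<alpha>))
                      (\<lambda>t. (Z (r k) \<omega> (real (r k) * t)
                              - (LINT s:{0..real (r k) * t}|lborel. lam (r k) \<omega> s)) / real (r k) powr \<alpha>) \<partial>M)
        \<longlonglongrightarrow> (\<integral>\<omega>. G (X \<omega>) (Ms \<omega>) \<partial>N)"
  shows "AE \<omega> in N. \<forall>t\<in>{0..1}.
     X \<omega> t = \<mu>s / lm * (LINT s:{0..t}|lborel. f_al \<alpha> lm (t - s) * s)
              + 1 / (lm * (K * Gamma (1 - \<alpha>) / \<alpha>)) * (LINT s:{0..t}|lborel. f_al \<alpha> lm (t - s) * Ms \<omega> s)"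
proof -
  interpret P: heavy_tail \<phi> \<alpha> K
    using phi_meas phi_nonneg phi_int phi_one alpha K_pos tail by unfold_locales auto
  interpret M: prob_space M using PRM by (simp add: poisson_random_measure_def)
  note dl = P.\<delta>_def[symmetric]
  define \<nu> where "\<nu> = \<mu>s * P.\<delta>"
  define c where "c n = \<mu> n * real n powr (1 - \<alpha>)" for n
  define XX where "XX j \<omega> = (\<lambda>t. Z (r j) \<omega> (real (r j) * t) / real (r j) powr (2 * \<alpha>))" for j \<omega>
  define YY where "YY j \<omega> = (\<lambda>t. (Z (r j) \<omega> (real (r j) * t)
    - (LINT s:{0..real (r j) * t}|lborel. lam (r j) \<omega> s)) / real (r j) powr \<alpha>)" for j \<omega>
  have c_lim: "c \<longlonglongrightarrow> \<nu>" using mu_rate by (simp add: c_def [abs_def] \<nu>_def dl mult.commute)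
  have rate: "(\<lambda>n. real n powr \<alpha> * (a n - 1)) \<longlonglongrightarrow> lm * P.\<delta>" using a_rate by (simp only: dl)
  note sub = LIMSEQ_subseq_LIMSEQ[OF _ subseq, unfolded comp_def]
  have law: "\<forall>G. skor_continuous2 G \<longrightarrow> (\<exists>B. \<forall>x y. \<bar>G x y\<bar> \<le> B) \<longrightarrow>
        (\<lambda>j. \<integral>\<omega>. G (XX j \<omega>) (YY j \<omega>) \<partial>M) \<longlonglongrightarrow> (\<integral>\<omega>. G (X \<omega>) (Ms \<omega>) \<partial>N)"
    using conv_law by (simp only: XX_def YY_def)
  \<comment> \<open>The subsequence may start with index 0, where the scaling degenerates;
    \<open>j \<le> r j\<close> excludes this for positive \<open>j\<close>.\<close>
  have pos: "eventually (\<lambda>j. 0 < r j) sequentially"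
    using eventually_gt_at_top[of 0] by eventually_elim (use seq_suble[OF subseq] in \<open>auto intro: less_le_trans\<close>)
  have paths: "AE \<omega> in M. hawkes_path \<phi> \<alpha> K (Z n \<omega>) (lam n \<omega>) (a n) (\<mu> n)" if n: "0 < n" for n
  proof -
    have n1: "1 \<le> n" using n by simp
    have pos_n: "0 \<le> a n" "0 < \<mu> n" using a_gt mu_pos n1 by (auto intro: less_imp_le[OF less_trans[OF zero_less_one]])
    show ?thesis
      using Z_sol[rule_format, OF n1]
    proof eventually_elim
      case (elim \<omega>)
      then show ?case using pos_n by unfold_locales auto
    qed
  qed
  \<comment> \<open>The exceptional null set depends on the time, so the integrated identity is
    obtained at rational times only.\<close>
  have "AE \<omega> in N. \<forall>q\<in>\<rat> \<inter> {0..1}.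
      P.\<delta> * (lm * conv unit_ind (\<lambda>s. unit_ind s * X \<omega> s) q)
        = conv (conv (ml_kernel \<alpha> lm) unit_ind) (\<lambda>s. unit_ind s * Ms \<omega> s) q
          + \<nu> * conv (conv (ml_kernel \<alpha> lm) unit_ind) (\<lambda>s. unit_ind s * s) q"
  proof (rule AE_ball_countable')
    show "countable (\<rat> \<inter> {0..1} :: real set)" using countable_rat by (rule countable_Int1)
    fix q :: real assume q: "q \<in> \<rat> \<inter> {0..1}"
    let ?F = "conv (ml_kernel \<alpha> lm) unit_ind"
    let ?D = "conv ?F (\<lambda>s. unit_ind s * s) q"
    \<comment> \<open>The sign \<sigma> is 1 or -1 and turns the one-sided criterion into an
      equality. The reflected kernels express the convolutions at time \<open>q\<close> as integrals
      against the paths.\<close>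
    let ?k = "\<lambda>\<sigma> s. \<sigma> * P.\<delta> * lm * unit_ind (q - s)" and ?h = "\<lambda>\<sigma> s. - \<sigma> * ?F (q - s)"
    have pf: "path_functional (?k \<sigma>) (?h \<sigma>) 0 0 (- \<sigma> * \<nu> * ?D) x y
        = \<sigma> * (P.\<delta> * (lm * conv unit_ind (\<lambda>s. unit_ind s * x s) q) - conv ?F (\<lambda>s. unit_ind s * y s) q - \<nu> * ?D)" for \<sigma> x y
    proof -
      have "(LINT s|lborel. ?k \<sigma> s * (unit_ind s * x s)) = \<sigma> * P.\<delta> * lm * conv unit_ind (\<lambda>s. unit_ind s * x s) q"
        unfolding LINT_reflected_kernel[symmetric] integral_mult_right_zero[symmetric] by (simp add: mult.assoc)
      moreover have "(LINT s|lborel. ?h \<sigma> s * (unit_ind s * y s)) = - \<sigma> * conv ?F (\<lambda>s. unit_ind s * y s) q"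
        unfolding LINT_reflected_kernel[symmetric] integral_mult_right_zero[symmetric] by (simp add: mult.assoc)
      ultimately show ?thesis by (simp only: path_functional_def) (simp add: algebra_simps)
    qed
    let ?\<epsilon> = "\<lambda>n. (LINT s|lborel. \<bar>ml_kernel \<alpha> lm s\<bar>) * (LINT w|lborel. \<bar>P.\<delta> * frac_kernel \<alpha> lm w - P.renewal_kernel (a n) n w\<bar>)
      + \<bar>c n - \<nu>\<bar> * \<bar>?D\<bar>"
    have "?\<epsilon> \<longlonglongrightarrow> (LINT s|lborel. \<bar>ml_kernel \<alpha> lm s\<bar>) * 0 + \<bar>\<nu> - \<nu>\<bar> * \<bar>?D\<bar>"
      by (intro tendsto_intros P.renewal_kernel_lim a_lim rate c_lim)
    then have \<epsilon>: "(\<lambda>j. ?\<epsilon> (r j)) \<longlonglongrightarrow> 0" by (intro sub) simp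
    have ki: "integrable lborel (?k \<sigma>)" for \<sigma>
      by (intro integrable_mult_right integrable_reflect integrable_unit_ind)
    have hi: "integrable lborel (?h \<sigma>)" for \<sigma>
      using alpha lam_pos
      by (intro integrable_mult_right integrable_reflect integrable_conv integrable_ml_kernel integrable_unit_ind) auto
    have fin: "AE \<omega> in N. path_functional (?k \<sigma>) (?h \<sigma>) 0 0 (- \<sigma> * \<nu> * ?D) (X \<omega>) (Ms \<omega>) \<le> 0" if \<sigma>: "\<bar>\<sigma>\<bar> = 1" for \<sigma>
    proof (rule law_limit_functional_nonpos[OF M.prob_space_axioms N_prob ki hi lim_cadlag lim_meas law _ \<epsilon>])
      show "eventually (\<lambda>j. AE \<omega> in M. path_functional (?k \<sigma>) (?h \<sigma>) 0 0 (- \<sigma> * \<nu> * ?D) (XX j \<omega>) (YY j \<omega>)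
          \<le> ?\<epsilon> (r j) * (1 + \<bar>XX j \<omega> 1\<bar>)) sequentially"
        using pos
      proof eventually_elim
        case (elim j)
        show ?case
          using paths[OF elim]
        proof eventually_elim
          case (elim \<omega>)
          interpret H: hawkes_path \<phi> \<alpha> K "Z (r j) \<omega>" "lam (r j) \<omega>" "a (r j)" "\<mu> (r j)" by (rule elim)
          let ?S = "P.\<delta> * (lm * conv unit_ind (H.scaled_z (r j)) q) - conv ?F (H.scaled_m (r j)) q - \<nu> * ?D"
          have x: "(\<lambda>s. unit_ind s * XX j \<omega> s) = H.scaled_z (r j)" "XX j \<omega> 1 = H.scaled_z (r j) 1"
            and y: "(\<lambda>s. unit_ind s * YY j \<omega> s) = H.scaled_m (r j)"
            by (simp_all add: fun_eq_iff XX_def YY_def H.scaled_z_def H.scaled_m_def)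
          have "\<sigma> * ?S \<le> \<bar>?S\<bar>" using \<sigma> abs_ge_self[of "\<sigma> * ?S"] by (simp add: abs_mult)
          also have "\<dots> \<le> (LINT s|lborel. \<bar>ml_kernel \<alpha> lm s\<bar>) * ((LINT w|lborel. \<bar>P.\<delta> * frac_kernel \<alpha> lm w - P.renewal_kernel (a (r j)) (r j) w\<bar>) * H.scaled_z (r j) 1)
              + \<bar>c (r j) - \<nu>\<bar> * \<bar>?D\<bar>"
            unfolding c_def using \<open>0 < r j\<close> q lam_pos by (intro H.scaled_functional_estimate) auto
          also have "\<dots> \<le> ?\<epsilon> (r j) * (1 + \<bar>H.scaled_z (r j) 1\<bar>)"
          proof -
            have "A * (B * u) + C \<le> (A * B + C) * (1 + \<bar>u\<bar>)" if "0 \<le> A" "0 \<le> B" "0 \<le> C" "0 \<le> u" for A B C u :: real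
            proof -
              have "0 \<le> A * B" "0 \<le> C * u" using that by simp_all
              then show ?thesis using that by (simp add: algebra_simps)
            qed
            then show ?thesis by (simp add: H.scaled_z_nonneg)
          qed
          finally show ?case by (simp only: pf x y)
        qed
      qed
    qed
    show "AE \<omega> in N. P.\<delta> * (lm * conv unit_ind (\<lambda>s. unit_ind s * X \<omega> s) q)
        = conv ?F (\<lambda>s. unit_ind s * Ms \<omega> s) q + \<nu> * ?D"
      using fin[of 1, simplified abs_one, OF refl] fin[of "- 1", simplified abs_minus abs_one, OF refl]
      by eventually_elim (simp only: pf, simp)
  qed
  \<comment> \<open>The limit form of the jump estimate at lag \<open>1 / real (Suc m)\<close>, with
    every kernel value replaced by its limit.\<close>
  moreover have "AE \<omega> in N. \<forall>m. X \<omega> 1 * (K / \<alpha> * (1 / real (Suc m)) powr (- \<alpha>) - lm * P.\<delta>) - Ms \<omega> 1 - \<nu>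
      \<le> K / \<alpha> * (1 / real (Suc m)) powr (- \<alpha>)
        * (LINT s|lborel. indicator {1 - 1 / real (Suc m)..1} s / (1 / real (Suc m)) * (unit_ind s * X \<omega> s))"
    unfolding AE_all_countable
  proof
    fix m
    define \<eta> where "\<eta> = 1 / real (Suc m)"
    have \<eta>: "0 < \<eta>" "\<eta> \<le> 1" by (auto simp: \<eta>_def)
    let ?u = "\<lambda>s. indicator {1 - \<eta>..1} s / \<eta> :: real" and ?P = "K / \<alpha> * \<eta> powr (- \<alpha>)"
    let ?k = "\<lambda>s. - ?P * ?u s" and ?b = "?P - lm * P.\<delta>"
    let ?Pn = "\<lambda>n. a n * (real n powr \<alpha> * (1 - P.cdf_phi (real n * \<eta>)))"
    have Pn: "?Pn \<longlonglongrightarrow> 1 * ?P" by (intro tendsto_mult a_lim P.scaled_tail_lim \<eta>)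
    have "(\<lambda>n. ?Pn n - real n powr \<alpha> * (a n - 1)) \<longlonglongrightarrow> 1 * ?P - lm * P.\<delta>"
      by (intro tendsto_diff Pn rate)
    then have Gn: "(\<lambda>n. P.renewal_kernel (a n) n \<eta>) \<longlonglongrightarrow> ?b"
      using \<eta> by (simp add: P.renewal_kernel_eq)
    let ?\<epsilon> = "\<lambda>n. \<bar>P.renewal_kernel (a n) n \<eta> - ?b\<bar> + \<bar>?Pn n - 1 * ?P\<bar> + \<bar>c n - \<nu>\<bar>"
    have "?\<epsilon> \<longlonglongrightarrow> \<bar>?b - ?b\<bar> + \<bar>1 * ?P - 1 * ?P\<bar> + \<bar>\<nu> - \<nu>\<bar>"
      by (intro tendsto_add tendsto_rabs tendsto_diff tendsto_const Gn Pn c_lim)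
    then have \<epsilon>: "(\<lambda>j. ?\<epsilon> (r j)) \<longlonglongrightarrow> 0" by (intro sub) simp
    have pf: "path_functional ?k (\<lambda>_. 0) ?b (- 1) (- \<nu>) x y
        = ?b * x 1 - y 1 - \<nu> - ?P * (LINT s|lborel. ?u s * (unit_ind s * x s))" for x y
      unfolding path_functional_def mult.assoc[of "- ?P"] integral_mult_right_zero by simp
    have ki: "integrable lborel ?k"
      by (intro integrable_mult_right integrable_divide) (use \<eta> in \<open>simp add: integrable_indicator_iff\<close>)
    have "AE \<omega> in N. path_functional ?k (\<lambda>_. 0) ?b (- 1) (- \<nu>) (X \<omega>) (Ms \<omega>) \<le> 0"
    proof (rule law_limit_functional_nonpos[OF M.prob_space_axioms N_prob ki integrable_zero lim_cadlag lim_meas law _ \<epsilon>])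
      show "eventually (\<lambda>j. AE \<omega> in M. path_functional ?k (\<lambda>_. 0) ?b (- 1) (- \<nu>) (XX j \<omega>) (YY j \<omega>)
          \<le> ?\<epsilon> (r j) * (1 + \<bar>XX j \<omega> 1\<bar>)) sequentially"
        using pos
      proof eventually_elim
        case (elim j)
        show ?case
          using paths[OF elim]
        proof eventually_elim
          case (elim \<omega>)
          interpret H: hawkes_path \<phi> \<alpha> K "Z (r j) \<omega>" "lam (r j) \<omega>" "a (r j)" "\<mu> (r j)" by (rule elim)
          let ?x = "H.scaled_z (r j)" and ?G = "P.renewal_kernel (a (r j)) (r j) \<eta>" and ?Q = "?Pn (r j)"
          define V where "V = (LINT s|lborel. ?u s * ?x s)"
          have x: "unit_ind s * XX j \<omega> s = ?x s" "XX j \<omega> 1 = ?x 1" and y: "YY j \<omega> 1 = H.scaled_m (r j) 1" for s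
            by (simp_all add: XX_def YY_def H.scaled_z_def H.scaled_m_def)
          have V: "V \<le> ?x 1" "0 \<le> V"
            using H.scaled_z_average_le[OF \<eta>, of "r j"] H.scaled_z_nonneg[of "r j" "1 - \<eta>"] by (auto simp: V_def)
          have "?x 1 * ?G \<le> H.scaled_m (r j) 1 + c (r j) + ?Q * V"
            unfolding c_def V_def by (rule H.scaled_jump_estimate[OF \<open>0 < r j\<close> \<eta>])
          \<comment> \<open>The estimate is rewritten with the limiting coefficients. Because
            \<open>V\<close> lies between 0 and \<open>?x 1\<close>, all replacement errors become
            multiples of \<open>1 + \<bar>?x 1\<bar>\<close>.\<close>
          then have "?b * ?x 1 - H.scaled_m (r j) 1 - \<nu> - ?P * V
              \<le> - (?G - ?b) * ?x 1 + (?Q - 1 * ?P) * V + (c (r j) - \<nu>)"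
            by (simp add: algebra_simps)
          also have "\<dots> \<le> \<bar>?G - ?b\<bar> * ?x 1 + \<bar>?Q - 1 * ?P\<bar> * ?x 1 + \<bar>c (r j) - \<nu>\<bar>"
          proof (intro add_mono)
            show "- (?G - ?b) * ?x 1 \<le> \<bar>?G - ?b\<bar> * ?x 1"
              by (intro mult_right_mono H.scaled_z_nonneg) simp
            show "(?Q - 1 * ?P) * V \<le> \<bar>?Q - 1 * ?P\<bar> * ?x 1" using V by (intro mult_mono) auto
          qed simp
          also have "\<dots> \<le> ?\<epsilon> (r j) * (1 + \<bar>?x 1\<bar>)"
          proof -
            have "A * u + B * u + C \<le> (A + B + C) * (1 + \<bar>u\<bar>)" if "0 \<le> A" "0 \<le> B" "0 \<le> C" "0 \<le> u" for A B C u :: real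
            proof -
              have "0 \<le> C * u" using that by simp
              then show ?thesis using that by (simp add: algebra_simps)
            qed
            then show ?thesis by (simp only: H.scaled_z_nonneg abs_ge_zero)
          qed
          finally show ?case by (simp only: pf x y V_def)
        qed
      qed
    qed
    then show "AE \<omega> in N. X \<omega> 1 * (K / \<alpha> * (1 / real (Suc m)) powr (- \<alpha>) - lm * P.\<delta>) - Ms \<omega> 1 - \<nu>
      \<le> K / \<alpha> * (1 / real (Suc m)) powr (- \<alpha>)
        * (LINT s|lborel. indicator {1 - 1 / real (Suc m)..1} s / (1 / real (Suc m)) * (unit_ind s * X \<omega> s))"
      unfolding \<eta>_def[symmetric]
    proof eventually_elim
      case (elim \<omega>)
      moreover have "X \<omega> 1 * ?b = ?b * X \<omega> 1" by (rule mult.commute)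
      ultimately show ?case unfolding pf by linarith
    qed
  qed
  \<comment> \<open>For the monotone prelimit paths this inequality is exact, so the error sequence
    is constantly 0.\<close>
  moreover have "AE \<omega> in N. \<forall>m. (LINT s|lborel. indicator {1 - 1 / real (Suc m)..1} s / (1 / real (Suc m)) * (unit_ind s * X \<omega> s)) \<le> X \<omega> 1"
    unfolding AE_all_countable
  proof
    fix m
    define \<eta> where "\<eta> = 1 / real (Suc m)"
    have \<eta>: "0 < \<eta>" "\<eta> \<le> 1" by (auto simp: \<eta>_def)
    let ?u = "\<lambda>s. indicator {1 - \<eta>..1} s / \<eta> :: real"
    have pf: "path_functional ?u (\<lambda>_. 0) (- 1) 0 0 x y = (LINT s|lborel. ?u s * (unit_ind s * x s)) - x 1" for x y
      by (simp add: path_functional_def)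
    have ui: "integrable lborel ?u"
      by (intro integrable_divide) (use \<eta> in \<open>simp add: integrable_indicator_iff\<close>)
    have "AE \<omega> in N. path_functional ?u (\<lambda>_. 0) (- 1) 0 0 (X \<omega>) (Ms \<omega>) \<le> 0"
    proof (rule law_limit_functional_nonpos[OF M.prob_space_axioms N_prob ui integrable_zero lim_cadlag lim_meas law _ tendsto_const])
      show "eventually (\<lambda>j. AE \<omega> in M. path_functional ?u (\<lambda>_. 0) (- 1) 0 0 (XX j \<omega>) (YY j \<omega>)
          \<le> 0 * (1 + \<bar>XX j \<omega> 1\<bar>)) sequentially"
        using pos
      proof eventually_elim
        case (elim j)
        show ?case
          using paths[OF elim]
        proof eventually_elim
          case (elim \<omega>)
          interpret H: hawkes_path \<phi> \<alpha> K "Z (r j) \<omega>" "lam (r j) \<omega>" "a (r j)" "\<mu> (r j)" by (rule elim)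
          have x: "unit_ind s * XX j \<omega> s = H.scaled_z (r j) s" "XX j \<omega> 1 = H.scaled_z (r j) 1" for s
            by (simp_all add: XX_def H.scaled_z_def)
          show ?case using H.scaled_z_average_le(1)[OF \<eta>, of "r j"] unfolding pf x by linarith
        qed
      qed
    qed
    then show "AE \<omega> in N. (LINT s|lborel. indicator {1 - 1 / real (Suc m)..1} s / (1 / real (Suc m)) * (unit_ind s * X \<omega> s)) \<le> X \<omega> 1"
      unfolding \<eta>_def[symmetric]
    proof eventually_elim
      case (elim \<omega>)
      then show ?case unfolding pf by linarith
    qed
  qed
  ultimately show ?thesis
    using AE_space
  proof eventually_elim
    case (elim \<omega>)
    have cad: "cadlag01 (X \<omega>)" "cadlag01 (Ms \<omega>)" using lim_cadlag elim(4) by auto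
    show ?case
    proof
      fix t :: real assume t: "t \<in> {0..1}"
      have "P.\<delta> * lm * X \<omega> t = P.limit_path lm \<nu> (Ms \<omega>) t"
        by (rule P.limit_path_characterization[OF lam_pos cad]) (use elim t in auto)
      also have "\<dots> = (LINT s:{0..t}|lborel. f_al \<alpha> lm (t - s) * Ms \<omega> s) + \<nu> * (LINT s:{0..t}|lborel. f_al \<alpha> lm (t - s) * s)"
        using t by (intro P.limit_path_eq[OF lam_pos cad(2)]) auto
      finally show "X \<omega> t = \<mu>s / lm * (LINT s:{0..t}|lborel. f_al \<alpha> lm (t - s) * s)
              + 1 / (lm * (K * Gamma (1 - \<alpha>) / \<alpha>)) * (LINT s:{0..t}|lborel. f_al \<alpha> lm (t - s) * Ms \<omega> s)"
        using P.delta_pos lam_pos unfolding dl \<nu>_def by (simp add: field_simps)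
    qed
  qed
qed

end
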